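(* In the setting described in the context, assume that $\mathcal{C}\subseteq\mathbb{R}^d$ is convex, closed and bounded; that $g(0)=0$ and $g(\boldsymbol\theta)\ge 0$; and that $g$ is both Lipschitz continuous and $\beta$-strongly convex over $\mathcal{C}$ (with $\beta>0$). Assume moreover that, for all $i\in[n]$, both the function $\boldsymbol\theta\mapsto F(\boldsymbol\theta;\boldsymbol x_i)$ and its Jacobian $\boldsymbol D_{F_i}(\boldsymbol\theta)$ are bounded on $\mathcal{C}$. Run SADM with $\gamma_t=ht$ and $\rho_t=\beta t$. Then: (i) $\|\bar{\boldsymbol\theta}_1^T-\bar{\boldsymbol\theta}_2^T\|_2^2=O\!\left(\frac{\log T}{T}\right)$ deterministically (i.e. for every realization of the samples); (ii) $\mathbb{E}[R^T]=O\!\left(\frac{\log T}{T}\right)$; (iii) there are constants $k_1,k_2>0$, not depending on $T$ or $M$, such that $$\mathbb{P}\left(R^T\ge k_1\frac{\log T}{T}+k_2\frac{M}{\sqrt T}\right)\le e^{-M^2/16}\qquad\text{for all } M>0,\ T\ge 3.$$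
   Context: Notation: $[n]=\{1,\dots,n\}$; $\|\cdot\|_p$ is the $\ell_p$ norm on $\mathbb{R}^N$ with $p\ge 1$. Data: points $\boldsymbol x_1,\dots,\boldsymbol x_n\in\mathbb{R}^m$; a function $F:\mathbb{R}^d\times\mathbb{R}^m\to\mathbb{R}^N$ that is smooth (in $\boldsymbol\theta$), with $\boldsymbol D_{F_i}(\boldsymbol\theta)\in\mathbb{R}^{N\times d}$ the Jacobian of $F(\boldsymbol\theta;\boldsymbol x_i)$ with respect to $\boldsymbol\theta$; a convex regularizer $g:\mathbb{R}^d\to\mathbb{R}$ with $\inf g>-\infty$; a convex set $\mathcal{C}\subseteq\mathbb{R}^d$ with indicator function $\chi_{\mathcal{C}}$ ($0$ on $\mathcal{C}$, $+\infty$ outside); a parameter $h>0$; and a fixed point $\boldsymbol\theta^k\in\mathcal{C}$ (the current iterate of an outer algorithm; $k$ is fixed throughout). Define $$F^{(k)}(\boldsymbol\theta;\boldsymbol x_i)=\|F(\boldsymbol\theta^k;\boldsymbol x_i)+\boldsymbol D_{F_i}(\boldsymbol\theta^k)(\boldsymbol\theta-\boldsymbol\theta^k)\|_p+\tfrac h2\|\boldsymbol\theta-\boldsymbol\theta^k\|_2^2,$$ $$F^{(k)}(\boldsymbol\theta)=\frac1n\sum_{i\in[n]}F^{(k)}(\boldsymbol\theta;\boldsymbol x_i),\qquad G(\boldsymbol\theta)=g(\boldsymbol\theta)+\chi_{\mathcal{C}}(\boldsymbol\theta).$$ The problem to be solved is: minimize $F^{(k)}(\boldsymbol\theta_1)+G(\boldsymbol\theta_2)$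 over $\boldsymbol\theta_1,\boldsymbol\theta_2\in\mathbb{R}^d$ subject to $\boldsymbol\theta_1=\boldsymbol\theta_2$. Let $\boldsymbol\theta^*=\boldsymbol\theta_1^*=\boldsymbol\theta_2^*$ denote its optimal solution. SADM (Stochastic Alternating Direction Method): start from $\boldsymbol\theta_1^1=\boldsymbol\theta_2^1=\boldsymbol u^1=0$. With scaling coefficients $\rho_t,\gamma_t>0$, at iterations $t=1,2,\dots,T$ draw a sample $\boldsymbol x_t$ uniformly at random from $\{\boldsymbol x_i\}_{i=1}^n$, independently across iterations ($\boldsymbol x_t$ denotes the point drawn at iteration $t$, not the $t$-th data point), and set $$\boldsymbol\theta_1^{t+1}=\arg\min_{\boldsymbol\theta_1}F^{(k)}(\boldsymbol\theta_1;\boldsymbol x_t)+\tfrac{\rho_t}{2}\|\boldsymbol\theta_1-\boldsymbol\theta_2^t+\boldsymbol u^t\|_2^2+\tfrac{\gamma_t}{2}\|\boldsymbol\theta_1-\boldsymbol\theta_1^t\|_2^2,$$ $$\boldsymbol\theta_2^{t+1}=\arg\min_{\boldsymbol\theta_2}G(\boldsymbol\theta_2)+\tfrac{\rho_t}{2}\|\boldsymbol\theta_1^{t+1}-\boldsymbol\theta_2+\boldsymbol u^t\|_2^2,$$ $$\boldsymbol u^{t+1}=\boldsymbol u^t+\boldsymbol\theta_1^{t+1}-\boldsymbol\theta_2^{t+1}.$$ Time averages and residual error: $$\bar{\boldsymbol\theta}_1^T=\frac1T\sum_{t=1}^T\boldsymbol\theta_1^t,\qquad \bar{\boldsymbol\theta}_2^T=\frac1T\sum_{t=1}^T\boldsymbol\theta_2^{t+1},\qquad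 R^T=F^{(k)}(\bar{\boldsymbol\theta}_1^T)+G(\bar{\boldsymbol\theta}_2^T)-F^{(k)}(\boldsymbol\theta^* )-G(\boldsymbol\theta^* ).$$ $O(\cdot)$ is as $T\to\infty$, with implied constants not depending on $T$ or on the realization of the samples. *)

theory Defs
  imports "HOL-Analysis.Analysis" "HOL-Probability.Probability" "HOL-Library.Landau_Symbols"
begin

definition lp_norm :: "real \<Rightarrow> real ^ 'k \<Rightarrow> real" where
  "lp_norm p v = (\<Sum>j\<in>UNIV. \<bar>v $ j\<bar> powr p) powr (1 / p)"

(* On a finite-dimensional domain, k-fold continuous differentiability is
   expressed through iterated directional derivatives. *)
primrec C_k :: "nat \<Rightarrow> ('a::euclidean_space \<Rightarrow> 'b::real_normed_vector) \<Rightarrow> bool" where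
  "C_k 0 f \<longleftrightarrow> continuous_on UNIV f"
| "C_k (Suc k) f \<longleftrightarrow>
     (\<forall>x. f differentiable (at x)) \<and> (\<forall>v. C_k k (\<lambda>x. frechet_derivative f (at x) v))"

definition smooth :: "('a::euclidean_space \<Rightarrow> 'b::real_normed_vector) \<Rightarrow> bool" where
  "smooth f \<longleftrightarrow> (\<forall>k. C_k k f)"

definition strongly_convex_on :: "real \<Rightarrow> 'a::real_inner set \<Rightarrow> ('a \<Rightarrow> real) \<Rightarrow> bool" where
  "strongly_convex_on \<beta> C g \<longleftrightarrow> convex C \<and>
     (\<forall>x\<in>C. \<forall>y\<in>C. \<forall>t. 0 \<le> t \<and> t \<le> 1 \<longrightarrow>
        g ((1 - t) *\<^sub>R x + t *\<^sub>R y)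
          \<le> (1 - t) * g x + t * g y - \<beta> / 2 * (t * (1 - t)) * (norm (x - y))\<^sup>2)"

(* The convex-analysis indicator, not the 0/1-valued library function indicator. *)
definition chi :: "'a set \<Rightarrow> 'a \<Rightarrow> ereal" where
  "chi C \<theta> = (if \<theta> \<in> C then 0 else \<infinity>)"

(* The model at a fixed data point x of the function f = (\<lambda>\<theta>. F \<theta> x). *)
definition loc_model ::
  "real \<Rightarrow> real \<Rightarrow> real ^ 'd \<Rightarrow> (real ^ 'd \<Rightarrow> real ^ 'N) \<Rightarrow> real ^ 'd \<Rightarrow> real" where
  "loc_model p h \<theta>k f \<theta> =
     lp_norm p (f \<theta>k + jacobian f (at \<theta>k) *v (\<theta> - \<theta>k)) + h / 2 * (norm (\<theta> - \<theta>k))\<^sup>2"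

definition avg_loss :: "nat \<Rightarrow> (nat \<Rightarrow> 'a \<Rightarrow> real) \<Rightarrow> 'a \<Rightarrow> real" where
  "avg_loss n L \<theta> = (1 / real n) * (\<Sum>i=1..n. L i \<theta>)"

(* sadm L G \<rho> \<gamma> s t is the triple of iterates number t (primal 1, primal 2, scaled dual), where
   L i is the loss at data point i and s t the index of the point drawn at iteration t.
   Numbering starts at t = 1; the value at t = 0 is a dummy that is never used. *)
primrec sadm ::
  "(nat \<Rightarrow> 'a::euclidean_space \<Rightarrow> real) \<Rightarrow> ('a \<Rightarrow> ereal) \<Rightarrow> (nat \<Rightarrow> real) \<Rightarrow> (nat \<Rightarrow> real)
     \<Rightarrow> (nat \<Rightarrow> nat) \<Rightarrow> nat \<Rightarrow> 'a \<times> 'a \<times> 'a" where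
  "sadm L G \<rho> \<gamma> s 0 = (0, 0, 0)"
| "sadm L G \<rho> \<gamma> s (Suc t) =
     (if t = 0 then (0, 0, 0)
      else
        (case sadm L G \<rho> \<gamma> s t of (a, b, u) \<Rightarrow>
          let a' = arg_min (\<lambda>\<theta>. L (s t) \<theta> + \<rho> t / 2 * (norm (\<theta> - b + u))\<^sup>2
                                          + \<gamma> t / 2 * (norm (\<theta> - a))\<^sup>2) (\<lambda>_. True);
              b' = arg_min (\<lambda>\<theta>. G \<theta> + ereal (\<rho> t / 2 * (norm (a' - \<theta> + u))\<^sup>2)) (\<lambda>_. True)
          in (a', b', u + a' - b')))"

definition theta1 where "theta1 L G \<rho> \<gamma> s t = fst (sadm L G \<rho> \<gamma> s t)"
definition theta2 where "theta2 L G \<rho> \<gamma> s t = fst (snd (sadm L G \<rho> \<gamma> s t))"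

definition theta1_avg where
  "theta1_avg L G \<rho> \<gamma> s T = (1 / real T) *\<^sub>R (\<Sum>t=1..T. theta1 L G \<rho> \<gamma> s t)"
definition theta2_avg where
  "theta2_avg L G \<rho> \<gamma> s T = (1 / real T) *\<^sub>R (\<Sum>t=1..T. theta2 L G \<rho> \<gamma> s (t + 1))"

definition residual where
  "residual n L G \<rho> \<gamma> \<theta>s s T =
     ereal (avg_loss n L (theta1_avg L G \<rho> \<gamma> s T)) + G (theta2_avg L G \<rho> \<gamma> s T)
       - ereal (avg_loss n L \<theta>s) - G \<theta>s"

end

theory Submission
  imports Defs
begin

text \<open>
  Write the loss at a data point as a convex Lipschitz function plus $\frac h2\|\cdot-\theta^k\|^2$. With
  $\rho_t=\beta t$ and $\gamma_t=ht$ the two strong convexity terms turn the usual ADMM inequality into a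
  telescoping one for the energy
  $\frac{\beta t}2\|\theta_2^t-\theta^*\|^2+\frac{ht}2\|\theta_1^t-\theta^*\|^2+\frac{\beta(t-1)}2\|u^t\|^2$,
  up to the term $\frac\beta2\|u^t\|^2$ caused by the growing penalty. The optimality condition of the first
  subproblem bounds $\|u^t\|$ by $\|\theta_1^{t+1}-\theta_2^t\|$, $\frac h\beta\|\theta_1^{t+1}-\theta_1^t\|$
  and a term of order $1/t$; the squares of the first two occur in the energy inequality with negative
  coefficients of order $t$, hence absorb that term for large $t$. So the energy grows at most linearly, the
  iterates and $u^t$ are bounded, and the gap of the averages is $O(1/T)$ because $u^{T+1}$ is the sum of all
  primal residuals. Replacing $\theta_1^{t+1}$ by $\theta_1^t$ in the sampled loss costs $O(1/t)$, which gives
  the logarithm; what separates the sampled regret from the residual is then a bounded martingale difference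
  sequence, controlled by Hoeffding's lemma.
\<close>

subsection \<open>The $\ell_p$ norm\<close>

text \<open>The obstacle is that the first block is unconstrained: its iterates may leave
  \<open>C\<close>, and the proximal quadratic in the loss is Lipschitz only on bounded sets. Until
  the iterates are bounded, only the global Lipschitz constant of the \<open>lp_norm\<close> part
  may be used; the quadratic must be played off against itself. The regret is moved back from
  \<theta>_1^{t+1} to \<theta>_1^t because the latter is determined before x_t is drawn, which makes
  the sampled loss there an unbiased estimate of the mean loss. All upper estimates hold against an
  arbitrary comparator in \<open>C\<close>. Minimality of \<theta>^* enters only for the lower
  estimate: the two averages differ, so the residual may be negative, while the O in (ii) is
  two-sided. Every random quantity depends on finitely many draws from a finite set. Expectations
  are thus finite averages over index tuples, conditioning on the past is summation over the last
  coordinate, and measurability of the \<open>arg_min\<close> selections follows from this finite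
  dependence.\<close>

lemma lp_norm_nonneg: "lp_norm p v \<ge> 0"
  by (simp add: lp_norm_def)

lemma lp_norm_powr:
  assumes "p \<ge> 1"
  shows "lp_norm p v powr p = (\<Sum>j\<in>UNIV. \<bar>v $ j\<bar> powr p)"
  using assms by (simp add: lp_norm_def powr_powr sum_nonneg)

lemma lp_norm_le_iff:
  assumes "p \<ge> 1" "r \<ge> 0"
  shows "lp_norm p v \<le> r \<longleftrightarrow> (\<Sum>j\<in>UNIV. \<bar>v $ j\<bar> powr p) \<le> r powr p"
proof -
  have "lp_norm p v \<le> r \<longleftrightarrow> lp_norm p v powr p \<le> r powr p"
    using assms lp_norm_nonneg[of p v] powr_less_mono2[of p r "lp_norm p v"]
      powr_mono2[of p "lp_norm p v" r] by force
  then show ?thesis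
    by (simp add: lp_norm_powr[OF assms(1)])
qed

lemma lp_norm_eq_0:
  assumes "p \<ge> 1" "lp_norm p v = 0"
  shows "v = 0"
proof -
  have "(\<Sum>j\<in>UNIV. \<bar>v $ j\<bar> powr p) = 0"
    using lp_norm_powr[OF assms(1), of v] assms(2) by simp
  then have "\<bar>v $ j\<bar> powr p = 0" for j
    by (subst (asm) sum_nonneg_eq_0_iff) auto
  then show ?thesis
    by (simp add: vec_eq_iff)
qed

lemma lp_norm_scaleR:
  assumes "p \<ge> 1"
  shows "lp_norm p (c *\<^sub>R v) = \<bar>c\<bar> * lp_norm p v"
proof -
  have "lp_norm p (c *\<^sub>R v) = (\<bar>c\<bar> powr p * (\<Sum>j\<in>UNIV. \<bar>v $ j\<bar> powr p)) powr (1 / p)"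
    unfolding lp_norm_def by (simp add: abs_mult powr_mult sum_distrib_left)
  also have "\<dots> = \<bar>c\<bar> * lp_norm p v"
    using assms by (simp add: lp_norm_def powr_mult powr_powr sum_nonneg)
  finally show ?thesis .
qed

lemma abs_powr_convex:
  fixes a b p t :: real
  assumes "p \<ge> 1" "0 \<le> t" "t \<le> 1"
  shows "\<bar>(1 - t) * a + t * b\<bar> powr p \<le> (1 - t) * \<bar>a\<bar> powr p + t * \<bar>b\<bar> powr p"
proof -
  \<comment> \<open>Used when \<open>a\<close> or \<open>b\<close> vanishes; convexity of the power
    is invoked only at positive arguments.\<close>
  have scale: "(r * s) powr p \<le> r * s powr p" if "0 \<le> r" "r \<le> 1" "0 \<le> s" for r s :: real
  proof -
    have "r powr p \<le> r"
      using that assms powr_mono'[of 1 p r] by (cases "r = 0") auto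
    then show ?thesis
      using that by (simp add: powr_mult mult_right_mono)
  qed
  have "\<bar>(1 - t) * a + t * b\<bar> \<le> (1 - t) * \<bar>a\<bar> + t * \<bar>b\<bar>"
    using assms abs_triangle_ineq[of "(1 - t) * a" "t * b"] by (simp add: abs_mult)
  then have "\<bar>(1 - t) * a + t * b\<bar> powr p \<le> ((1 - t) * \<bar>a\<bar> + t * \<bar>b\<bar>) powr p"
    using assms by (intro powr_mono2) auto
  also have "\<dots> \<le> (1 - t) * \<bar>a\<bar> powr p + t * \<bar>b\<bar> powr p"
  proof (cases "a = 0 \<or> b = 0")
    case True
    then show ?thesis
      using scale[of t "\<bar>b\<bar>"] scale[of "1 - t" "\<bar>a\<bar>"] assms by auto
  next
    case False
    then show ?thesis
      using convex_onD[OF powr_convex[OF assms(1)], of t "\<bar>a\<bar>" "\<bar>b\<bar>"] assms by simp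
  qed
  finally show ?thesis .
qed

text \<open>Minkowski by normalization: \<open>u + v\<close> is \<open>a + b\<close> times a convex
  combination of two vectors of norm 1, and the unit ball is convex because it is a sublevel set of
  the convex sum of powers.\<close>

lemma lp_norm_triangle:
  assumes "p \<ge> 1"
  shows "lp_norm p (u + v) \<le> lp_norm p u + lp_norm p v"
proof (cases "lp_norm p u = 0 \<or> lp_norm p v = 0")
  case True
  then show ?thesis
    using lp_norm_eq_0[OF assms] lp_norm_nonneg by force
next
  case False
  define a b where "a = lp_norm p u" and "b = lp_norm p v"
  have ab: "a > 0" "b > 0"
    using False lp_norm_nonneg[of p u] lp_norm_nonneg[of p v] by (auto simp: a_def b_def)
  define t where "t = b / (a + b)"
  have t: "0 \<le> t" "t \<le> 1" "(1 - t) * (a + b) = a" "t * (a + b) = b"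
    using ab by (auto simp: t_def field_simps)
  define u' v' where "u' = (1 / a) *\<^sub>R u" and "v' = (1 / b) *\<^sub>R v"
  have one: "(\<Sum>j\<in>UNIV. \<bar>u' $ j\<bar> powr p) \<le> 1" "(\<Sum>j\<in>UNIV. \<bar>v' $ j\<bar> powr p) \<le> 1"
  proof -
    have "lp_norm p u' \<le> 1" "lp_norm p v' \<le> 1"
      using ab by (simp_all add: u'_def v'_def lp_norm_scaleR[OF assms] flip: a_def b_def)
    then show "(\<Sum>j\<in>UNIV. \<bar>u' $ j\<bar> powr p) \<le> 1" "(\<Sum>j\<in>UNIV. \<bar>v' $ j\<bar> powr p) \<le> 1"
      using lp_norm_le_iff[OF assms, of 1] by auto
  qed
  have "(\<Sum>j\<in>UNIV. \<bar>((1 - t) *\<^sub>R u' + t *\<^sub>R v') $ j\<bar> powr p)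
      \<le> (\<Sum>j\<in>UNIV. (1 - t) * \<bar>u' $ j\<bar> powr p + t * \<bar>v' $ j\<bar> powr p)"
    using abs_powr_convex[OF assms t(1,2)] by (intro sum_mono) simp
  also have "\<dots> \<le> (1 - t) * 1 + t * 1"
    unfolding sum.distrib sum_distrib_left[symmetric]
    using one t by (intro add_mono mult_left_mono) auto
  finally have le1: "lp_norm p ((1 - t) *\<^sub>R u' + t *\<^sub>R v') \<le> 1"
    by (subst lp_norm_le_iff[OF assms]) auto
  have "(a + b) *\<^sub>R ((1 - t) *\<^sub>R u' + t *\<^sub>R v')
      = (((1 - t) * (a + b)) / a) *\<^sub>R u + ((t * (a + b)) / b) *\<^sub>R v"
    by (simp add: u'_def v'_def scaleR_right_distrib mult.commute)
  also have "\<dots> = u + v"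
    unfolding t using ab by simp
  finally have "lp_norm p (u + v) = (a + b) * lp_norm p ((1 - t) *\<^sub>R u' + t *\<^sub>R v')"
    using lp_norm_scaleR[OF assms, of "a + b" "(1 - t) *\<^sub>R u' + t *\<^sub>R v'"] ab by simp
  also have "\<dots> \<le> (a + b) * 1"
    using le1 ab by (intro mult_left_mono) auto
  finally show ?thesis
    by (simp add: a_def b_def)
qed

lemma lp_norm_le_norm:
  fixes v :: "real ^ 'k"
  assumes "p \<ge> 1"
  shows "lp_norm p v \<le> real CARD('k) powr (1 / p) * norm v"
proof (subst lp_norm_le_iff[OF assms])
  have "(\<Sum>j\<in>UNIV. \<bar>v $ j\<bar> powr p) \<le> (\<Sum>j\<in>(UNIV :: 'k set). norm v powr p)"
    using assms by (intro sum_mono powr_mono2) (auto simp: component_le_norm_cart)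
  then show "(\<Sum>j\<in>UNIV. \<bar>v $ j\<bar> powr p) \<le> (real CARD('k) powr (1 / p) * norm v) powr p"
    using assms by (simp add: powr_mult powr_powr)
qed auto

lemma lp_norm_affine_convex:
  assumes "p \<ge> 1"
  shows "convex_on UNIV (\<lambda>\<theta>. lp_norm p (a + J *v (\<theta> - c)))"
proof (rule convex_onI)
  fix t :: real and y z assume t: "0 < t" "t < 1"
  have "a + J *v ((1 - t) *\<^sub>R y + t *\<^sub>R z - c)
      = (1 - t) *\<^sub>R (a + J *v (y - c)) + t *\<^sub>R (a + J *v (z - c))"
  proof -
    have "(1 - t) *\<^sub>R y + t *\<^sub>R z - c = (1 - t) *\<^sub>R (y - c) + t *\<^sub>R (z - c)"
      by (simp add: algebra_simps)
    then show ?thesis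
      by (simp add: matrix_vector_right_distrib matrix_vector_mult_scaleR algebra_simps)
  qed
  then show "lp_norm p (a + J *v ((1 - t) *\<^sub>R y + t *\<^sub>R z - c))
      \<le> (1 - t) * lp_norm p (a + J *v (y - c)) + t * lp_norm p (a + J *v (z - c))"
    using lp_norm_triangle[OF assms, of "(1 - t) *\<^sub>R (a + J *v (y - c))" "t *\<^sub>R (a + J *v (z - c))"] t
    by (simp add: lp_norm_scaleR[OF assms])
qed auto

text \<open>The bound is global in \<open>y\<close> and \<open>z\<close>, as required for iterates
  that are not confined to \<open>C\<close>. The factor in front of the operator norm compares the
  l_p norm with the Euclidean one.\<close>

lemma lp_norm_affine_Lipschitz:
  fixes J :: "real ^ 'd ^ 'k"
  assumes "p \<ge> 1"
  shows "\<bar>lp_norm p (a + J *v (y - c)) - lp_norm p (a + J *v (z - c))\<bar>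
    \<le> real CARD('k) powr (1 / p) * onorm ((*v) J) * norm (y - z)"
proof -
  have half: "lp_norm p (a + J *v (y - c)) - lp_norm p (a + J *v (z - c))
    \<le> real CARD('k) powr (1 / p) * onorm ((*v) J) * norm (y - z)" for y z
  proof -
    have eq: "a + J *v (y - c) = (a + J *v (z - c)) + J *v (y - z)"
      by (simp add: matrix_vector_mult_diff_distrib)
    have "lp_norm p (a + J *v (y - c)) - lp_norm p (a + J *v (z - c)) \<le> lp_norm p (J *v (y - z))"
      unfolding eq using lp_norm_triangle[OF assms, of "a + J *v (z - c)" "J *v (y - z)"] by simp
    also have "\<dots> \<le> real CARD('k) powr (1 / p) * norm (J *v (y - z))"
      by (rule lp_norm_le_norm[OF assms])
    also have "\<dots> \<le> real CARD('k) powr (1 / p) * (onorm ((*v) J) * norm (y - z))"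
      by (intro mult_left_mono onorm) auto
    finally show ?thesis
      by (simp add: mult.assoc)
  qed
  from half[of y z] half[of z y] show ?thesis
    by (simp add: norm_minus_commute abs_le_iff)
qed

subsection \<open>Minimizers and elementary inequalities\<close>

text \<open>First-order optimality without differentiating \<phi>: compare \<open>x\<close> with the
  point at fraction \<open>t\<close> on the segment to \<open>y\<close>, divide by \<open>t\<close>
  and let \<open>t\<close> tend to 0. Of the quadratic \<open>q\<close> only its gradient
  \<open>w\<close> at \<open>x\<close> survives, while the modulus \<mu> is kept in full.\<close>

lemma strongly_convex_on_minimizer:
  fixes \<phi> q :: "'a::real_inner \<Rightarrow> real"
  assumes sc: "strongly_convex_on \<mu> S \<phi>" and x: "x \<in> S" and y: "y \<in> S"
    and min: "\<And>y. y \<in> S \<Longrightarrow> \<phi> x + q x \<le> \<phi> y + q y"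
    and q: "\<And>y. q y = q x + w \<bullet> (y - x) + c / 2 * (norm (y - x))\<^sup>2"
  shows "\<phi> x - \<phi> y \<le> w \<bullet> (y - x) - \<mu> / 2 * (norm (y - x))\<^sup>2"
proof -
  define N where "N = (norm (y - x))\<^sup>2"
  define A where "A = w \<bullet> (y - x)"
  have step: "\<phi> x - \<phi> y \<le> A - \<mu> / 2 * N + t * (\<mu> / 2 * N + c / 2 * N)" if t: "0 < t" "t < 1" for t
  proof -
    define z where "z = (1 - t) *\<^sub>R x + t *\<^sub>R y"
    have zx: "z - x = t *\<^sub>R (y - x)"
      by (simp add: z_def algebra_simps)
    have "z \<in> S"
      using sc x y t by (auto simp: z_def strongly_convex_on_def intro!: convexD)
    then have "\<phi> x + q x \<le> \<phi> z + q z"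
      by (rule min)
    moreover have "\<phi> z \<le> (1 - t) * \<phi> x + t * \<phi> y - \<mu> / 2 * (t * (1 - t)) * N"
      using sc x y t unfolding strongly_convex_on_def N_def z_def by (metis less_eq_real_def norm_minus_commute)
    moreover have "q z = q x + t * A + c / 2 * t\<^sup>2 * N"
      by (subst q) (simp add: zx A_def N_def power_mult_distrib)
    ultimately have "t * (\<phi> x - \<phi> y) \<le> t * (A - \<mu> / 2 * N + t * (\<mu> / 2 * N + c / 2 * N))"
      by (simp add: algebra_simps power2_eq_square add_divide_distrib diff_divide_distrib)
    then show ?thesis
      using t by simp
  qed
  have "((\<lambda>t. A - \<mu> / 2 * N + t * (\<mu> / 2 * N + c / 2 * N)) \<longlongrightarrow> A - \<mu> / 2 * N + 0 * (\<mu> / 2 * N + c / 2 * N))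
      (at_right 0)"
    by (intro tendsto_intros)
  moreover have "\<forall>\<^sub>F t in at_right 0. \<phi> x - \<phi> y \<le> A - \<mu> / 2 * N + t * (\<mu> / 2 * N + c / 2 * N)"
    unfolding eventually_at_right_field using step by (intro exI[of _ 1]) auto
  ultimately have "\<phi> x - \<phi> y \<le> A - \<mu> / 2 * N + 0 * (\<mu> / 2 * N + c / 2 * N)"
    by (rule tendsto_lowerbound) simp
  then show ?thesis
    by (simp add: A_def N_def)
qed

lemma convex_on_strongly_convex_on_0:
  "convex_on S f \<Longrightarrow> strongly_convex_on 0 S f"
  unfolding strongly_convex_on_def by (auto simp: convex_on_imp_convex dest: convex_onD)

lemma norm_sq_expand_at:
  fixes x y b :: "'a::real_inner"
  shows "(norm (y - b))\<^sup>2 = (norm (x - b))\<^sup>2 + 2 * ((x - b) \<bullet> (y - x)) + (norm (y - x))\<^sup>2"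
  by (simp add: power2_norm_eq_inner inner_diff_left inner_diff_right inner_commute algebra_simps)

text \<open>Since \<open>a' - b + u = u' + b' - b\<close>, the left side is
  \<open>2 u'.(u - u') + 2 (b' - b).(z - a')\<close>. Polarizing both products produces the squared
  norm of \<open>a' - b'\<close> with opposite signs, so it cancels.\<close>

lemma admm_identity:
  fixes a a' b b' u u' z :: "'a::real_inner"
  assumes "u' = u + a' - b'"
  shows "2 * ((a' - b + u) \<bullet> (z - a')) - 2 * (u' \<bullet> (z - b'))
    = (norm u)\<^sup>2 - (norm u')\<^sup>2 + (norm (b - z))\<^sup>2 - (norm (b' - z))\<^sup>2 - (norm (a' - b))\<^sup>2"
  unfolding assms power2_norm_eq_inner
  by (simp add: inner_diff_left inner_diff_right inner_add_left inner_add_right inner_commute algebra_simps)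

lemma norm_sq_convex_combination:
  fixes x y :: "'a::real_inner"
  shows "(norm ((1 - t) *\<^sub>R x + t *\<^sub>R y))\<^sup>2
    = (1 - t) * (norm x)\<^sup>2 + t * (norm y)\<^sup>2 - t * (1 - t) * (norm (x - y))\<^sup>2"
  unfolding power2_norm_eq_inner
  by (simp add: inner_diff_left inner_diff_right inner_add_left inner_add_right inner_commute algebra_simps)

lemma coercive_attains_min:
  fixes f :: "'a::euclidean_space \<Rightarrow> real"
  assumes cont: "continuous_on UNIV f" and \<kappa>: "\<kappa> > 0" and coercive: "\<And>y. \<kappa> * (norm (y - c))\<^sup>2 \<le> f y"
  shows "\<exists>x. \<forall>y. f x \<le> f y"
proof -
  \<comment> \<open>Outside this ball the lower bound already exceeds \<open>f c\<close>, so a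
    minimum over the ball is global.\<close>
  define r where "r = sqrt (f c / \<kappa>)"
  have fc: "f c \<ge> 0"
    using coercive[of c] by simp
  have "r \<ge> 0"
    using fc \<kappa> by (simp add: r_def)
  obtain x where x: "x \<in> cball c r" "\<And>y. y \<in> cball c r \<Longrightarrow> f x \<le> f y"
    using continuous_attains_inf[of "cball c r" f] cont \<open>r \<ge> 0\<close>
    by (metis cball_eq_empty compact_cball continuous_on_subset not_le subset_UNIV)
  have "f x \<le> f y" if "y \<notin> cball c r" for y
  proof -
    have "f x \<le> f c"
      using x(2)[of c] \<open>r \<ge> 0\<close> by simp
    also have "\<dots> = \<kappa> * r\<^sup>2"
      using fc \<kappa> by (simp add: r_def)
    also have "\<dots> \<le> \<kappa> * (norm (y - c))\<^sup>2"
      using that \<kappa> \<open>r \<ge> 0\<close> by (intro mult_left_mono power_mono) (auto simp: dist_norm norm_minus_commute)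
    finally show ?thesis
      using coercive[of y] by linarith
  qed
  then show ?thesis
    using x(2) by blast
qed

lemma is_arg_min_arg_min:
  "\<exists>x. is_arg_min f P x \<Longrightarrow> is_arg_min f P (arg_min f P)"
  unfolding arg_min_def by (rule someI_ex)

lemma four_square_le:
  fixes a b c d :: real
  shows "(a + b + c + d)\<^sup>2 \<le> 4 * (a\<^sup>2 + b\<^sup>2 + c\<^sup>2 + d\<^sup>2)"
proof -
  have "4 * (a\<^sup>2 + b\<^sup>2 + c\<^sup>2 + d\<^sup>2) - (a + b + c + d)\<^sup>2
      = (a - b)\<^sup>2 + (a - c)\<^sup>2 + (a - d)\<^sup>2 + (b - c)\<^sup>2 + (b - d)\<^sup>2 + (c - d)\<^sup>2"
    by (simp add: power2_eq_square algebra_simps)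
  then show ?thesis
    by (smt (verit) zero_le_power2)
qed

lemma sum_inverse_le_ln:
  assumes "T \<ge> 1"
  shows "(\<Sum>t=1..T. 1 / real t) \<le> 1 + ln (real T)"
  using assms
proof (induction T rule: dec_induct)
  case (step T)
  have "1 - real T / real (Suc T) = 1 / real (Suc T)"
    by (simp add: field_simps)
  moreover have "ln (real T / real (Suc T)) \<le> real T / real (Suc T) - 1"
    using step by (intro ln_le_minus_one) auto
  ultimately have "1 / real (Suc T) \<le> ln (real (Suc T)) - ln (real T)"
    using step by (subst (asm) ln_div) auto
  then show ?case
    using step by simp
qed simp

subsection \<open>One step of SADM\<close>

text \<open>Abstracts from the l_p model: \<open>\<phi> i\<close> is the loss without its proximal
  quadratic, \<open>c\<close> stands for \<theta>^k, and \<open>z\<close> is the comparator, any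
  point of \<open>C\<close>.\<close>

locale sadm_problem =
  fixes n :: nat and \<phi> :: "nat \<Rightarrow> 'a::euclidean_space \<Rightarrow> real" and h \<beta> D :: real and c z :: 'a
    and g :: "'a \<Rightarrow> real" and C :: "'a set"
  assumes n: "n \<ge> 1" and h: "h > 0" and \<beta>: "\<beta> > 0" and D: "D \<ge> 0"
    and \<phi>_convex: "\<And>i. i \<in> {1..n} \<Longrightarrow> convex_on UNIV (\<phi> i)"
    and \<phi>_Lipschitz: "\<And>i y w. i \<in> {1..n} \<Longrightarrow> \<bar>\<phi> i y - \<phi> i w\<bar> \<le> D * norm (y - w)"
    and \<phi>_nonneg: "\<And>i y. i \<in> {1..n} \<Longrightarrow> \<phi> i y \<ge> 0"
    and compact: "compact C" and z: "z \<in> C"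
    and g_nonneg: "\<And>y. g y \<ge> 0"
    and g_continuous: "continuous_on C g"
    and g_strongly_convex: "strongly_convex_on \<beta> C g"
begin

definition loss :: "nat \<Rightarrow> 'a \<Rightarrow> real" where
  "loss i y = \<phi> i y + h / 2 * (norm (y - c))\<^sup>2"

definition reg :: "'a \<Rightarrow> ereal" where
  "reg y = ereal (g y) + chi C y"

definition th1 :: "(nat \<Rightarrow> nat) \<Rightarrow> nat \<Rightarrow> 'a" where
  "th1 = theta1 loss reg (\<lambda>t. \<beta> * real t) (\<lambda>t. h * real t)"

definition th2 :: "(nat \<Rightarrow> nat) \<Rightarrow> nat \<Rightarrow> 'a" where
  "th2 = theta2 loss reg (\<lambda>t. \<beta> * real t) (\<lambda>t. h * real t)"

definition dual :: "(nat \<Rightarrow> nat) \<Rightarrow> nat \<Rightarrow> 'a" where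
  "dual s t = snd (snd (sadm loss reg (\<lambda>t. \<beta> * real t) (\<lambda>t. h * real t) s t))"

definition valid :: "(nat \<Rightarrow> nat) \<Rightarrow> bool" where
  "valid s \<longleftrightarrow> (\<forall>t\<ge>1. s t \<in> {1..n})"

lemma validD: "valid s \<Longrightarrow> t \<ge> 1 \<Longrightarrow> s t \<in> {1..n}"
  by (simp add: valid_def)

lemma initial: "th1 s 1 = 0" "th2 s 1 = 0" "dual s 1 = 0"
  by (simp_all add: th1_def th2_def dual_def theta1_def theta2_def)

lemma loss_nonneg:
  assumes "i \<in> {1..n}"
  shows "h / 2 * (norm (y - c))\<^sup>2 \<le> loss i y" "0 \<le> loss i y"
  using \<phi>_nonneg[OF assms, of y] h by (auto simp: loss_def)

lemma loss_continuous:
  assumes "i \<in> {1..n}"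
  shows "continuous_on UNIV (loss i)"
proof -
  have "D-lipschitz_on UNIV (\<phi> i)"
    using D \<phi>_Lipschitz[OF assms] by (auto intro!: lipschitz_onI simp: dist_norm)
  then have "continuous_on UNIV (\<phi> i)"
    by (rule lipschitz_on_continuous_on)
  then show ?thesis
    unfolding loss_def by (intro continuous_intros) auto
qed

text \<open>\<open>arg_min\<close> is a choice operator and says something only if a minimizer
  exists. Existence comes from the coercive quadratic of the loss in the first subproblem and from
  compactness of \<open>C\<close> in the second.\<close>

lemma sadm_step:
  assumes t: "t \<ge> 1" and s: "s t \<in> {1..n}"
  defines "a \<equiv> th1 s t" and "b \<equiv> th2 s t" and "u \<equiv> dual s t"
    and "a' \<equiv> th1 s (Suc t)" and "b' \<equiv> th2 s (Suc t)" and "u' \<equiv> dual s (Suc t)"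
  shows "\<And>y. loss (s t) a' + \<beta> * t / 2 * (norm (a' - b + u))\<^sup>2 + h * t / 2 * (norm (a' - a))\<^sup>2
           \<le> loss (s t) y + \<beta> * t / 2 * (norm (y - b + u))\<^sup>2 + h * t / 2 * (norm (y - a))\<^sup>2"
    and "b' \<in> C"
    and "\<And>y. y \<in> C \<Longrightarrow> g b' + \<beta> * t / 2 * (norm (a' - b' + u))\<^sup>2 \<le> g y + \<beta> * t / 2 * (norm (a' - y + u))\<^sup>2"
    and "u' = u + a' - b'"
proof -
  let ?\<rho> = "\<lambda>t. \<beta> * real t" and ?\<gamma> = "\<lambda>t. h * real t"
  let ?S = "sadm loss reg ?\<rho> ?\<gamma> s"
  define f where "f = (\<lambda>\<theta>. loss (s t) \<theta> + \<beta> * t / 2 * (norm (\<theta> - b + u))\<^sup>2 + h * t / 2 * (norm (\<theta> - a))\<^sup>2)"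
  define k where "k = (\<lambda>\<theta>. reg \<theta> + ereal (\<beta> * t / 2 * (norm (a' - \<theta> + u))\<^sup>2))"
  have St: "?S t = (a, b, u)"
    by (simp add: a_def b_def u_def th1_def th2_def dual_def theta1_def theta2_def)
  have a': "a' = arg_min f (\<lambda>_. True)"
    using St t by (simp add: a'_def th1_def theta1_def Let_def f_def)
  have "?S (Suc t) = (a', arg_min k (\<lambda>_. True), u + a' - arg_min k (\<lambda>_. True))"
    using St t a' by (simp add: Let_def f_def k_def)
  then have b': "b' = arg_min k (\<lambda>_. True)" and u': "u' = u + a' - b'"
    by (simp_all add: b'_def u'_def th2_def dual_def theta2_def)
  show "u' = u + a' - b'"
    by fact
  have "continuous_on UNIV f"
    unfolding f_def by (intro continuous_intros loss_continuous s)
  moreover have "h / 2 * (norm (y - c))\<^sup>2 \<le> f y" for y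
    unfolding f_def using loss_nonneg(1)[OF s, of y] h \<beta> by (simp add: add_increasing2)
  ultimately obtain x where "\<forall>y. f x \<le> f y"
    using coercive_attains_min[of f "h / 2" c] h by auto
  then have "is_arg_min f (\<lambda>_. True) a'"
    unfolding a' by (intro is_arg_min_arg_min exI[of _ x]) (auto simp: is_arg_min_linorder)
  then show "loss (s t) a' + \<beta> * t / 2 * (norm (a' - b + u))\<^sup>2 + h * t / 2 * (norm (a' - a))\<^sup>2
      \<le> loss (s t) y + \<beta> * t / 2 * (norm (y - b + u))\<^sup>2 + h * t / 2 * (norm (y - a))\<^sup>2" for y
    by (simp add: is_arg_min_linorder f_def)
  define k' where "k' = (\<lambda>\<theta>. g \<theta> + \<beta> * t / 2 * (norm (a' - \<theta> + u))\<^sup>2)"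
  have k: "k y = (if y \<in> C then ereal (k' y) else \<infinity>)" for y
    by (simp add: k_def k'_def reg_def chi_def)
  have "continuous_on C k'"
    unfolding k'_def by (intro continuous_intros g_continuous)
  then obtain x where "x \<in> C" "\<forall>y\<in>C. k' x \<le> k' y"
    using continuous_attains_inf[OF compact] z by blast
  then have "is_arg_min k (\<lambda>_. True) b'"
    unfolding b' by (intro is_arg_min_arg_min exI[of _ x]) (auto simp: is_arg_min_linorder k)
  then have min: "k b' \<le> k y" for y
    by (simp add: is_arg_min_linorder)
  \<comment> \<open>The objective is finite at \<open>z\<close>, hence at the minimizer, which
    excludes points outside \<open>C\<close>.\<close>
  from min[of z] show "b' \<in> C"
    using z by (simp add: k split: if_splits)
  then show "g b' + \<beta> * t / 2 * (norm (a' - b' + u))\<^sup>2 \<le> g y + \<beta> * t / 2 * (norm (a' - y + u))\<^sup>2"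
    if "y \<in> C" for y
    using min[of y] that by (simp add: k k'_def)
qed

text \<open>\<open>w\<close> is the gradient of the penalty and proximal terms at the new iterate.
  Adding the gradient of the quadratic part of the loss gives minus a subgradient of
  \<open>\<phi> (s t)\<close>, whose length is at most the Lipschitz constant
  \<open>D\<close>.\<close>

lemma optimality:
  assumes t: "t \<ge> 1" and s: "s t \<in> {1..n}"
  defines "a \<equiv> th1 s t" and "b \<equiv> th2 s t" and "u \<equiv> dual s t"
    and "a' \<equiv> th1 s (Suc t)" and "b' \<equiv> th2 s (Suc t)" and "u' \<equiv> dual s (Suc t)"
  defines "w \<equiv> (\<beta> * t) *\<^sub>R (a' - b + u) + (h * t) *\<^sub>R (a' - a)"
  shows "\<And>y. loss (s t) a' - loss (s t) y \<le> w \<bullet> (y - a') - h / 2 * (norm (y - a'))\<^sup>2"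
    and "norm (w + h *\<^sub>R (a' - c)) \<le> D"
    and "\<And>y. y \<in> C \<Longrightarrow> g b' - g y \<le> - (\<beta> * t) * (u' \<bullet> (y - b')) - \<beta> / 2 * (norm (y - b'))\<^sup>2"
proof -
  note step = sadm_step[where s = s and t = t, OF t s, folded a_def b_def u_def a'_def b'_def u'_def]
  define v where "v = w + h *\<^sub>R (a' - c)"
  \<comment> \<open>The quadratic of the loss is moved into \<open>q\<close> as well; expanding it
    exactly at \<open>a'\<close> afterwards returns the strong convexity term with factor
    \<open>h / 2\<close>.\<close>
  define q where "q = (\<lambda>y. \<beta> * t / 2 * (norm (y - (b - u)))\<^sup>2 + h * t / 2 * (norm (y - a))\<^sup>2
    + h / 2 * (norm (y - c))\<^sup>2)"
  have \<phi>_step: "\<phi> (s t) a' - \<phi> (s t) y \<le> v \<bullet> (y - a')" for y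
  proof -
    have "\<phi> (s t) a' - \<phi> (s t) y \<le> v \<bullet> (y - a') - 0 / 2 * (norm (y - a'))\<^sup>2"
    proof (rule strongly_convex_on_minimizer[where S = UNIV and q = q and c = "\<beta> * t + h * t + h"])
      show "strongly_convex_on 0 UNIV (\<phi> (s t))"
        by (rule convex_on_strongly_convex_on_0[OF \<phi>_convex[OF s]])
      show "\<phi> (s t) a' + q a' \<le> \<phi> (s t) y + q y" for y
        using step(1)[of y] by (simp add: loss_def q_def algebra_simps)
      show "q y = q a' + v \<bullet> (y - a') + (\<beta> * t + h * t + h) / 2 * (norm (y - a'))\<^sup>2" for y
        unfolding q_def norm_sq_expand_at[of y "b - u" a'] norm_sq_expand_at[of y a a']
          norm_sq_expand_at[of y c a'] v_def w_def
        by (simp add: inner_add_left inner_diff_left algebra_simps add_divide_distrib)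
    qed auto
    then show ?thesis by simp
  qed
  show "loss (s t) a' - loss (s t) y \<le> w \<bullet> (y - a') - h / 2 * (norm (y - a'))\<^sup>2" for y
    using \<phi>_step[of y] unfolding loss_def norm_sq_expand_at[of y c a'] v_def
    by (simp add: inner_add_left algebra_simps add_divide_distrib)
  \<comment> \<open>Testing with \<open>y = a' - v\<close> turns the subgradient inequality into a
    bound on \<open>v\<close>.\<close>
  have "v \<bullet> v \<le> D * norm v"
    using \<phi>_step[of "a' - v"] \<phi>_Lipschitz[OF s, of "a' - v" a'] by simp
  then have "norm v * norm v \<le> D * norm v"
    by (simp add: power2_norm_eq_inner[symmetric] power2_eq_square)
  then show "norm (w + h *\<^sub>R (a' - c)) \<le> D"
    using D unfolding v_def[symmetric] by (cases "norm v = 0") auto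
  show "g b' - g y \<le> - (\<beta> * t) * (u' \<bullet> (y - b')) - \<beta> / 2 * (norm (y - b'))\<^sup>2" if y: "y \<in> C" for y
  proof -
    define q' where "q' = (\<lambda>y. \<beta> * t / 2 * (norm (y - (a' + u)))\<^sup>2)"
    have q': "q' y = \<beta> * t / 2 * (norm (a' - y + u))\<^sup>2" for y
    proof -
      have "a' - y + u = - (y - (a' + u))"
        by simp
      then show ?thesis
        unfolding q'_def by (simp only: norm_minus_cancel)
    qed
    have "g b' - g y \<le> ((- \<beta> * t) *\<^sub>R u') \<bullet> (y - b') - \<beta> / 2 * (norm (y - b'))\<^sup>2"
    proof (rule strongly_convex_on_minimizer[OF g_strongly_convex step(2) y, where q = q' and c = "\<beta> * t"])
      show "g b' + q' b' \<le> g y + q' y" if "y \<in> C" for y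
        unfolding q' using that by (rule step(3))
      have e: "b' - (a' + u) = - u'"
        using step(4) by simp
      show "q' y = q' b' + ((- \<beta> * t) *\<^sub>R u') \<bullet> (y - b') + \<beta> * t / 2 * (norm (y - b'))\<^sup>2" for y
        unfolding q'_def norm_sq_expand_at[of y "a' + u" b'] e
        by (simp add: distrib_left right_diff_distrib)
    qed
    then show ?thesis by simp
  qed
qed

text \<open>The dual weight lags by one: a step at time \<open>t\<close> controls the new dual with
  weight \<open>t\<close>, and no strong convexity lifts this to \<open>t + 1\<close>. The primal
  weights are lifted, by \<beta> and \<open>h\<close> respectively.\<close>

definition energy :: "(nat \<Rightarrow> nat) \<Rightarrow> nat \<Rightarrow> real" where
  "energy s t = \<beta> * t / 2 * (norm (th2 s t - z))\<^sup>2 + h * t / 2 * (norm (th1 s t - z))\<^sup>2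
    + \<beta> * (real t - 1) / 2 * (norm (dual s t))\<^sup>2"

text \<open>Both optimality inequalities are tested at \<open>z\<close> and added. The penalty
  products \<open>X\<close> and \<open>Y\<close> carry the same factor and combine by
  \<open>admm_identity\<close>; the proximal product \<open>Z\<close> is a three-point
  identity.\<close>

lemma energy_step:
  assumes t: "t \<ge> 1" and s: "s t \<in> {1..n}"
  shows "loss (s t) (th1 s (Suc t)) + g (th2 s (Suc t)) - loss (s t) z - g z + energy s (Suc t)
    \<le> energy s t + \<beta> / 2 * (norm (dual s t))\<^sup>2
      - \<beta> * t / 2 * (norm (th1 s (Suc t) - th2 s t))\<^sup>2 - h * t / 2 * (norm (th1 s (Suc t) - th1 s t))\<^sup>2"
proof -
  define a b u a' b' u' where "a = th1 s t" and "b = th2 s t" and "u = dual s t"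
    and "a' = th1 s (Suc t)" and "b' = th2 s (Suc t)" and "u' = dual s (Suc t)"
  note defs = this
  define X Y Z where "X = (a' - b + u) \<bullet> (z - a')" and "Y = u' \<bullet> (z - b')" and "Z = (a' - a) \<bullet> (z - a')"
  note opt = optimality[where s = s and t = t, OF t s, folded defs]
  have 1: "loss (s t) a' - loss (s t) z \<le> \<beta> * t * X + h * t * Z - h / 2 * (norm (a' - z))\<^sup>2"
    using opt(1)[of z] by (simp add: X_def Z_def inner_add_left norm_minus_commute)
  have 2: "g b' - g z \<le> - (\<beta> * t * Y) - \<beta> / 2 * (norm (b' - z))\<^sup>2"
    using opt(3)[OF z] by (simp add: Y_def norm_minus_commute)
  have XY: "2 * X - 2 * Y
      = (norm u)\<^sup>2 - (norm u')\<^sup>2 + (norm (b - z))\<^sup>2 - (norm (b' - z))\<^sup>2 - (norm (a' - b))\<^sup>2"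
    unfolding X_def Y_def
    by (rule admm_identity) (rule sadm_step(4)[where s = s and t = t, OF t s, folded defs])
  have Z: "2 * Z = (norm (a - z))\<^sup>2 - (norm (a' - z))\<^sup>2 - (norm (a' - a))\<^sup>2"
    unfolding Z_def norm_sq_expand_at[of a z a']
    by (simp add: norm_minus_commute inner_diff_left inner_diff_right inner_commute algebra_simps)
  have XY': "\<beta> * t * X - \<beta> * t * Y = \<beta> * t / 2 *
      ((norm u)\<^sup>2 - (norm u')\<^sup>2 + (norm (b - z))\<^sup>2 - (norm (b' - z))\<^sup>2 - (norm (a' - b))\<^sup>2)"
    unfolding XY[symmetric] by (simp add: algebra_simps)
  have Z': "h * t * Z = h * t / 2 * ((norm (a - z))\<^sup>2 - (norm (a' - z))\<^sup>2 - (norm (a' - a))\<^sup>2)"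
    unfolding Z[symmetric] by simp
  have "loss (s t) a' + g b' - loss (s t) z - g z
      \<le> (\<beta> * t * X - \<beta> * t * Y) + h * t * Z - h / 2 * (norm (a' - z))\<^sup>2 - \<beta> / 2 * (norm (b' - z))\<^sup>2"
    using 1 2 by linarith
  then show ?thesis
    unfolding energy_def defs[symmetric] XY' Z'
    by (simp add: algebra_simps add_divide_distrib diff_divide_distrib)
qed

text \<open>The subgradient bound is solved for the dual and divided by \<open>\<beta> t\<close>.
  The subgradient and the pull towards \<open>c\<close> do not scale with \<open>t\<close>, whence
  the last two terms; the factor 4 of \<open>four_square_le\<close> over \<open>2 \<beta>\<close>
  gives the 2.\<close>

lemma dual_bound:
  assumes t: "t \<ge> 1" and s: "s t \<in> {1..n}"
  shows "\<beta> / 2 * (norm (dual s t))\<^sup>2 \<le> 2 * \<beta> * (norm (th1 s (Suc t) - th2 s t))\<^sup>2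
    + 2 * h\<^sup>2 / \<beta> * (norm (th1 s (Suc t) - th1 s t))\<^sup>2
    + 2 * h\<^sup>2 / \<beta> * (norm (th1 s (Suc t) - c))\<^sup>2 / t\<^sup>2 + 2 * D\<^sup>2 / \<beta> / t\<^sup>2"
proof -
  define a b u a' where "a = th1 s t" and "b = th2 s t" and "u = dual s t" and "a' = th1 s (Suc t)"
  note defs = this
  define v where "v = (\<beta> * t) *\<^sub>R (a' - b + u) + (h * t) *\<^sub>R (a' - a) + h *\<^sub>R (a' - c)"
  have v: "norm v \<le> D"
    using optimality(2)[where s = s and t = t, OF t s, folded defs] by (simp add: v_def)
  have t0: "real t > 0"
    using t by simp
  have eq: "(\<beta> * t) *\<^sub>R u = v - (\<beta> * t) *\<^sub>R (a' - b) - (h * t) *\<^sub>R (a' - a) - h *\<^sub>R (a' - c)"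
    by (simp add: v_def algebra_simps)
  have "norm ((\<beta> * t) *\<^sub>R u) \<le> norm v + norm ((\<beta> * t) *\<^sub>R (a' - b)) + norm ((h * t) *\<^sub>R (a' - a))
      + norm (h *\<^sub>R (a' - c))"
    unfolding eq using norm_triangle_ineq4[of v "(\<beta> * t) *\<^sub>R (a' - b)"]
      norm_triangle_ineq4[of "v - (\<beta> * t) *\<^sub>R (a' - b)" "(h * t) *\<^sub>R (a' - a)"]
      norm_triangle_ineq4[of "v - (\<beta> * t) *\<^sub>R (a' - b) - (h * t) *\<^sub>R (a' - a)" "h *\<^sub>R (a' - c)"]
    by linarith
  then have "\<beta> * t * norm u \<le> \<beta> * t * norm (a' - b) + h * t * norm (a' - a) + h * norm (a' - c) + D"
    using v h \<beta> by simp
  then have "\<beta> * norm u \<le> \<beta> * norm (a' - b) + h * norm (a' - a) + h * norm (a' - c) / t + D / t"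
    using t0 by (simp add: field_simps)
  then have "(\<beta> * norm u)\<^sup>2 \<le> (\<beta> * norm (a' - b) + h * norm (a' - a) + h * norm (a' - c) / t + D / t)\<^sup>2"
    using \<beta> by (intro power_mono) auto
  also have "\<dots> \<le> 4 * ((\<beta> * norm (a' - b))\<^sup>2 + (h * norm (a' - a))\<^sup>2 + (h * norm (a' - c) / t)\<^sup>2 + (D / t)\<^sup>2)"
    by (rule four_square_le)
  finally have "(\<beta> * norm u)\<^sup>2 / (2 * \<beta>)
      \<le> 4 * ((\<beta> * norm (a' - b))\<^sup>2 + (h * norm (a' - a))\<^sup>2 + (h * norm (a' - c) / t)\<^sup>2 + (D / t)\<^sup>2) / (2 * \<beta>)"
    using \<beta> by (intro divide_right_mono) auto
  moreover have "(\<beta> * norm u)\<^sup>2 / (2 * \<beta>) = \<beta> / 2 * (norm u)\<^sup>2"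
    using \<beta> by (simp add: power2_eq_square)
  moreover have "4 * ((\<beta> * norm (a' - b))\<^sup>2 + (h * norm (a' - a))\<^sup>2 + (h * norm (a' - c) / t)\<^sup>2 + (D / t)\<^sup>2) / (2 * \<beta>)
      = 2 * \<beta> * (norm (a' - b))\<^sup>2 + 2 * h\<^sup>2 / \<beta> * (norm (a' - a))\<^sup>2
        + 2 * h\<^sup>2 / \<beta> * (norm (a' - c))\<^sup>2 / t\<^sup>2 + 2 * D\<^sup>2 / \<beta> / t\<^sup>2"
    using \<beta> t0 by (simp add: field_simps power2_eq_square)
  ultimately show ?thesis
    unfolding defs[symmetric] by linarith
qed

text \<open>For large \<open>t\<close> the energy inequality has enough negative curvature to absorb the dual term that
  the growing penalty leaves behind.\<close>

lemma dual_absorbed: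
  assumes s: "s t \<in> {1..n}" and t: "real t \<ge> 4" "real t \<ge> 8 * h / \<beta>"
  shows "\<beta> / 2 * (norm (dual s t))\<^sup>2 \<le> \<beta> * t / 2 * (norm (th1 s (Suc t) - th2 s t))\<^sup>2
    + h * t / 4 * (norm (th1 s (Suc t) - th1 s t))\<^sup>2
    + 2 * h\<^sup>2 / \<beta> * (norm (th1 s (Suc t) - c))\<^sup>2 / t\<^sup>2 + 2 * D\<^sup>2 / \<beta> / t\<^sup>2"
proof -
  \<comment> \<open>The two thresholds on \<open>t\<close> are those at which the coefficients of
    \<open>dual_bound\<close> fit. Only half of the proximal coefficient \<open>h t / 2\<close> is
    spent here.\<close>
  have "2 * \<beta> \<le> \<beta> * t / 2"
    using \<beta> t(1) by simp
  moreover have "2 * h\<^sup>2 / \<beta> \<le> h * t / 4"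
  proof -
    have "2 * h\<^sup>2 / \<beta> = h * (8 * h / \<beta>) / 4"
      by (simp add: power2_eq_square)
    also have "\<dots> \<le> h * t / 4"
      using t(2) h by (intro divide_right_mono mult_left_mono) auto
    finally show ?thesis .
  qed
  ultimately have "2 * \<beta> * (norm (th1 s (Suc t) - th2 s t))\<^sup>2 \<le> \<beta> * t / 2 * (norm (th1 s (Suc t) - th2 s t))\<^sup>2"
    "2 * h\<^sup>2 / \<beta> * (norm (th1 s (Suc t) - th1 s t))\<^sup>2 \<le> h * t / 4 * (norm (th1 s (Suc t) - th1 s t))\<^sup>2"
    by (intro mult_right_mono; simp)+
  then show ?thesis
    using dual_bound[of t s] s t(1) by simp
qed

end

subsection \<open>Boundedness of the iterates and regret\<close>

context sadm_problem
begin

text \<open>The starting triple is the same for all samples; the constant sequence is a mere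
  representative that keeps later constants independent of \<open>s\<close>.\<close>

lemma energy_1: "energy s 1 = energy (\<lambda>_. 0) 1"
  unfolding energy_def initial ..

lemma energy_nonneg: "t \<ge> 1 \<Longrightarrow> 0 \<le> energy s t"
  using h \<beta> by (auto simp: energy_def intro!: add_nonneg_nonneg)

lemma energy_ge:
  assumes "t \<ge> 1"
  shows "h * t / 2 * (norm (th1 s t - z))\<^sup>2 \<le> energy s t"
    and "\<beta> * (real t - 1) / 2 * (norm (dual s t))\<^sup>2 \<le> energy s t"
  using assms h \<beta> by (auto simp: energy_def intro!: add_nonneg_nonneg)

lemma dual_le_energy:
  assumes "t \<ge> 2"
  shows "\<beta> / 2 * (norm (dual s t))\<^sup>2 \<le> energy s t"
proof -
  have "\<beta> / 2 * (norm (dual s t))\<^sup>2 \<le> \<beta> * (real t - 1) / 2 * (norm (dual s t))\<^sup>2"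
    using assms \<beta> by (intro mult_right_mono divide_right_mono) auto
  also have "\<dots> \<le> energy s t"
    using assms by (intro energy_ge) auto
  finally show ?thesis .
qed

text \<open>Before the threshold \<open>N\<close> the dual term is bounded by the energy itself, so
  the energy may double in each of finitely many steps. From \<open>N\<close> on it is absorbed and
  each step adds at most a constant.\<close>

lemma energy_bound: "\<exists>K\<ge>0::real. \<forall>s. valid s \<longrightarrow> (\<forall>t\<ge>1. energy s t \<le> K * t)"
proof -
  define E where "E = (\<Sum>i=1..n. loss i z) + g z"
  define E' where "E' = E + 2 * D\<^sup>2 / \<beta>"
  define B where "B = energy (\<lambda>_. 0) 1 + E"
  define N where "N = nat \<lceil>max 4 (8 * h / \<beta>)\<rceil>"
  have E_ge: "loss i z + g z \<le> E" if "i \<in> {1..n}" for i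
    using member_le_sum[of i "{1..n}" "\<lambda>i. loss i z"] loss_nonneg that by (auto simp: E_def)
  have E: "E \<ge> 0"
    using E_ge[of 1] loss_nonneg(2)[of 1 z] g_nonneg[of z] n by simp
  have E': "E' \<ge> 0"
    using E \<beta> by (simp add: E'_def)
  have B: "B \<ge> E"
    using energy_nonneg[of 1] by (simp add: B_def)
  have N: "real t \<ge> 4" "real t \<ge> 8 * h / \<beta>" if "t \<ge> N" for t
  proof -
    have "max 4 (8 * h / \<beta>) \<le> real N"
      unfolding N_def by linarith
    then show "real t \<ge> 4" "real t \<ge> 8 * h / \<beta>"
      using that by (simp_all add: order_trans)
  qed
  have doubling: "energy s (Suc t) \<le> 2 * energy s t + E" if s: "valid s" and t: "t \<ge> 1" for s t
  proof -
    have "\<beta> / 2 * (norm (dual s t))\<^sup>2 \<le> energy s t"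
      using dual_le_energy[of t s] energy_nonneg[OF t, of s] t initial
      by (cases "t = 1") auto
    moreover have "0 \<le> loss (s t) (th1 s (Suc t))" "0 \<le> g (th2 s (Suc t))"
      using loss_nonneg(2)[OF validD[OF s t]] g_nonneg by auto
    moreover have "0 \<le> \<beta> * t / 2 * (norm (th1 s (Suc t) - th2 s t))\<^sup>2"
      "0 \<le> h * t / 2 * (norm (th1 s (Suc t) - th1 s t))\<^sup>2"
      using h \<beta> by auto
    ultimately show ?thesis
      using energy_step[where s = s and t = t, OF t validD[OF s t]] E_ge[OF validD[OF s t]] by linarith
  qed
  have linear: "energy s (Suc t) \<le> energy s t + E'" if s: "valid s" and t: "t \<ge> 1" "t \<ge> N" for s t
  proof -
    have i: "s t \<in> {1..n}"
      by (rule validD[OF s t(1)])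
    have t1: "1 \<le> (real t)\<^sup>2" "real t \<le> (real t)\<^sup>2"
      using t(1) one_le_power[of "real t" 2] self_le_power[of "real t" 2] by auto
    \<comment> \<open>The new iterate is not yet known to be bounded, so its remainder term is
      charged to the quadratic contained in the sampled loss on the left of the energy
      inequality.\<close>
    have "2 * h\<^sup>2 / \<beta> / t\<^sup>2 \<le> h / 2"
    proof -
      have "2 * h\<^sup>2 / \<beta> / t\<^sup>2 = h / 4 * (8 * h / \<beta>) / t\<^sup>2"
        by (simp add: power2_eq_square)
      also have "\<dots> \<le> h / 4 * (real t)\<^sup>2 / t\<^sup>2"
        using order_trans[OF N(2)[OF t(2)] t1(2)] h by (intro divide_right_mono mult_left_mono) auto
      also have "\<dots> \<le> h / 2"
        using h t(1) by simp
      finally show ?thesis .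
    qed
    then have "2 * h\<^sup>2 / \<beta> / t\<^sup>2 * (norm (th1 s (Suc t) - c))\<^sup>2 \<le> h / 2 * (norm (th1 s (Suc t) - c))\<^sup>2"
      by (rule mult_right_mono) simp
    also have "\<dots> \<le> loss (s t) (th1 s (Suc t))"
      by (rule loss_nonneg(1)[OF i])
    finally have "2 * h\<^sup>2 / \<beta> / t\<^sup>2 * (norm (th1 s (Suc t) - c))\<^sup>2 \<le> loss (s t) (th1 s (Suc t))" .
    moreover have "2 * D\<^sup>2 / \<beta> / t\<^sup>2 \<le> 2 * D\<^sup>2 / \<beta>"
      using t1 t(1) \<beta> divide_left_mono[of 1 "(real t)\<^sup>2" "2 * D\<^sup>2 / \<beta>"] by simp
    moreover have "0 \<le> h * t / 4 * (norm (th1 s (Suc t) - th1 s t))\<^sup>2"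
      using h by auto
    moreover have "\<beta> / 2 * (norm (dual s t))\<^sup>2 \<le> \<beta> * t / 2 * (norm (th1 s (Suc t) - th2 s t))\<^sup>2
      + h * t / 4 * (norm (th1 s (Suc t) - th1 s t))\<^sup>2
      + 2 * h\<^sup>2 / \<beta> / t\<^sup>2 * (norm (th1 s (Suc t) - c))\<^sup>2 + 2 * D\<^sup>2 / \<beta> / t\<^sup>2"
      using dual_absorbed[where s = s and t = t, OF i N[OF t(2)]] by simp
    ultimately show ?thesis
      using energy_step[where s = s and t = t, OF t(1) i] E_ge[OF i] g_nonneg[of "th2 s (Suc t)"]
      unfolding E'_def by linarith
  qed
  \<comment> \<open>Energy plus \<open>E\<close> at most doubles in each step, which explains the
    subtracted \<open>E\<close>.\<close>
  have early: "energy s t \<le> 2 ^ t * B - E" if s: "valid s" and t: "t \<ge> 1" for s t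
    using t
  proof (induction t rule: dec_induct)
    case base
    then show ?case
      using energy_1[of s] B E by (simp add: B_def)
  next
    case (step t)
    then show ?case
      using doubling[OF s, of t] by simp
  qed
  \<comment> \<open>The constant dominates the whole doubling phase; the slope takes over from
    \<open>N\<close> on.\<close>
  have "energy s t \<le> 2 ^ N * B + E' * t" if s: "valid s" and t: "t \<ge> 1" for s t
    using t
  proof (induction t rule: nat_induct_at_least)
    case base
    show ?case
    proof -
      have "energy s 1 \<le> B"
        using energy_1[of s] E by (simp add: B_def)
      also have "\<dots> \<le> 2 ^ N * B"
        using B E by (simp add: mult_le_cancel_right1)
      finally show ?thesis
        using E' by simp
    qed
  next
    case (Suc t)
    show ?case
    proof (cases "t \<ge> N")
      case True
      then show ?thesis
        using linear[OF s, of t] Suc by (simp add: algebra_simps)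
    next
      case False
      then have "2 ^ Suc t * B \<le> 2 ^ N * B"
        using B E by (intro mult_right_mono power_increasing) auto
      moreover have "0 \<le> E' * real (Suc t)"
        using E' by simp
      ultimately show ?thesis
        using early[OF s, of "Suc t"] E by linarith
    qed
  qed
  moreover have "2 ^ N * B + E' * t \<le> (2 ^ N * B + E') * t" if "t \<ge> 1" for t :: nat
    using that mult_left_mono[of 1 "real t" "2 ^ N * B"] B E by (simp add: distrib_right)
  ultimately show ?thesis
    using B E E' by (intro exI[of _ "2 ^ N * B + E'"]) (auto intro: order_trans)
qed

text \<open>The weights in the energy are of order \<open>t\<close>, so linear growth is enough.
  \<open>R\<close> also covers \<open>C\<close>, because later Lipschitz estimates compare iterates
  with points of \<open>C\<close>.\<close>

lemma iterates_bounded: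
  "\<exists>R\<ge>0. (\<forall>y\<in>C. norm (y - z) \<le> R) \<and>
     (\<forall>s. valid s \<longrightarrow> (\<forall>t\<ge>1. norm (th1 s t - z) \<le> R \<and> norm (dual s t) \<le> R))"
proof -
  obtain K :: real where K: "K \<ge> 0" "\<And>s t. valid s \<Longrightarrow> t \<ge> 1 \<Longrightarrow> energy s t \<le> K * t"
    using energy_bound by blast
  obtain r where r: "\<And>y. y \<in> C \<Longrightarrow> norm y \<le> r"
    using compact_imp_bounded[OF compact] by (metis bounded_iff)
  have K0: "0 \<le> sqrt (2 * K / h)"
    using K(1) h by simp
  define R where "R = max (2 * r) (max (sqrt (2 * K / h)) (sqrt (4 * K / \<beta>)))"
  have "norm (y - z) \<le> R" if "y \<in> C" for y
    using r[OF that] r[OF z] norm_triangle_ineq4[of y z] by (simp add: R_def)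
  moreover have "norm (th1 s t - z) \<le> R" if s: "valid s" and t: "t \<ge> 1" for s t
  proof -
    have "h * t / 2 * (norm (th1 s t - z))\<^sup>2 \<le> energy s t"
      by (rule energy_ge(1)[OF t])
    also have "\<dots> \<le> K * t"
      by (rule K(2)[OF s t])
    finally have "real t * (h / 2 * (norm (th1 s t - z))\<^sup>2) \<le> real t * K"
      by (simp add: mult_ac)
    then have "h / 2 * (norm (th1 s t - z))\<^sup>2 \<le> K"
      using t by (subst (asm) mult_le_cancel_left_pos) auto
    then have "(norm (th1 s t - z))\<^sup>2 \<le> 2 * K / h"
      using h by (simp add: pos_le_divide_eq mult_ac)
    then have "norm (th1 s t - z) \<le> sqrt (2 * K / h)"
      by (rule real_le_rsqrt)
    then show ?thesis
      unfolding R_def by linarith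
  qed
  moreover have "norm (dual s t) \<le> R" if s: "valid s" and t: "t \<ge> 1" for s t
  proof (cases "t = 1")
    case True
    then have "norm (dual s t) = 0"
      using initial(3)[of s] by simp
    then show ?thesis
      using K0 unfolding R_def by linarith
  next
    case False
    then have t2: "real t \<ge> 2"
      using t by simp
    have "\<beta> * (real t - 1) / 2 * (norm (dual s t))\<^sup>2 \<le> energy s t"
      by (rule energy_ge(2)[OF t])
    also have "\<dots> \<le> K * t"
      by (rule K(2)[OF s t])
    \<comment> \<open>The dual weight is only \<open>t - 1\<close>, but
      \<open>t \<le> 2 (t - 1)\<close> from \<open>t = 2\<close> on; at \<open>t = 1\<close> the
      dual is zero.\<close>
    also have "\<dots> \<le> K * (2 * (real t - 1))"
      using K(1) t2 by (intro mult_left_mono) auto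
    finally have "(real t - 1) * (\<beta> / 2 * (norm (dual s t))\<^sup>2) \<le> (real t - 1) * (2 * K)"
      by (simp add: mult_ac)
    then have "\<beta> / 2 * (norm (dual s t))\<^sup>2 \<le> 2 * K"
      using t2 by (subst (asm) mult_le_cancel_left_pos) auto
    then have "(norm (dual s t))\<^sup>2 \<le> 4 * K / \<beta>"
      using \<beta> by (simp add: pos_le_divide_eq mult_ac)
    then have "norm (dual s t) \<le> sqrt (4 * K / \<beta>)"
      by (rule real_le_rsqrt)
    then show ?thesis
      unfolding R_def by linarith
  qed
  moreover have "R \<ge> 0"
    using K0 unfolding R_def by linarith
  ultimately show ?thesis
    by (intro exI[of _ R]) simp
qed

text \<open>One number serving all sample sequences and all times, so that constants built from it
  depend on the problem alone.\<close>

definition radius :: real where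
  "radius = (SOME R. R \<ge> 0 \<and> (\<forall>y\<in>C. norm (y - z) \<le> R) \<and>
     (\<forall>s. valid s \<longrightarrow> (\<forall>t\<ge>1. norm (th1 s t - z) \<le> R \<and> norm (dual s t) \<le> R)))"

lemma radius_nonneg: "radius \<ge> 0"
  and radius_C: "y \<in> C \<Longrightarrow> norm (y - z) \<le> radius"
  and radius_th1: "valid s \<Longrightarrow> t \<ge> 1 \<Longrightarrow> norm (th1 s t - z) \<le> radius"
  and radius_dual: "valid s \<Longrightarrow> t \<ge> 1 \<Longrightarrow> norm (dual s t) \<le> radius"
  using someI_ex[OF iterates_bounded, folded radius_def] by auto

text \<open>Lipschitz constant of the full loss on the ball of this radius about \<open>z\<close>,
  where the gradient of the quadratic has length at most
  \<open>h (radius + norm (z - c))\<close>.\<close>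

definition Lip :: real where
  "Lip = D + h * (radius + norm (z - c))"

lemma Lip_nonneg: "Lip \<ge> 0"
  using D h radius_nonneg by (simp add: Lip_def)

lemma loss_Lipschitz:
  assumes i: "i \<in> {1..n}" and y: "norm (y - z) \<le> radius" and w: "norm (w - z) \<le> radius"
  shows "\<bar>loss i y - loss i w\<bar> \<le> Lip * norm (y - w)"
proof -
  have "(norm (y - c))\<^sup>2 - (norm (w - c))\<^sup>2 = (y - w) \<bullet> ((y - c) + (w - c))"
    unfolding power2_norm_eq_inner
    by (simp add: inner_diff_left inner_diff_right inner_add_right inner_commute)
  also have "\<bar>\<dots>\<bar> \<le> norm (y - w) * norm ((y - c) + (w - c))"
    by (rule Cauchy_Schwarz_ineq2)
  also have "\<dots> \<le> norm (y - w) * (2 * (radius + norm (z - c)))"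
  proof (intro mult_left_mono)
    have "norm (y - c) \<le> radius + norm (z - c)" "norm (w - c) \<le> radius + norm (z - c)"
      using y w norm_triangle_ineq[of "y - z" "z - c"] norm_triangle_ineq[of "w - z" "z - c"] by auto
    then have "norm ((y - c) + (w - c)) \<le> (radius + norm (z - c)) + (radius + norm (z - c))"
      by (intro order_trans[OF norm_triangle_ineq add_mono])
    then show "norm ((y - c) + (w - c)) \<le> 2 * (radius + norm (z - c))"
      by simp
  qed auto
  finally have "h / 2 * \<bar>(norm (y - c))\<^sup>2 - (norm (w - c))\<^sup>2\<bar>
      \<le> h / 2 * (norm (y - w) * (2 * (radius + norm (z - c))))"
    using h by (intro mult_left_mono) auto
  then have "\<bar>h / 2 * ((norm (y - c))\<^sup>2 - (norm (w - c))\<^sup>2)\<bar> \<le> h * (radius + norm (z - c)) * norm (y - w)"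
    using h by (simp only: abs_mult) (simp add: algebra_simps)
  moreover have "loss i y - loss i w = (\<phi> i y - \<phi> i w) + h / 2 * ((norm (y - c))\<^sup>2 - (norm (w - c))\<^sup>2)"
    by (simp add: loss_def algebra_simps)
  ultimately show ?thesis
    using \<phi>_Lipschitz[OF i, of y w] unfolding Lip_def distrib_right by linarith
qed

text \<open>The difference between the losses at consecutive iterates costs $O(1/t)$ against the remaining
  half of the proximal term; this is the source of the logarithm.\<close>

lemma regret_step:
  "\<exists>K\<ge>0::real. \<forall>s. valid s \<longrightarrow> (\<forall>t\<ge>1. loss (s t) (th1 s t) + g (th2 s (Suc t)) - loss (s t) z - g z
     \<le> energy s t - energy s (Suc t) + K / t)"
proof -
  define N where "N = max 4 (8 * h / \<beta>)"
  \<comment> \<open>\<open>K1\<close> collects the remainders of \<open>dual_absorbed\<close>, with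
    the iterate now bounded. \<open>K2\<close> pays for the times below \<open>N\<close>, where the
    dual is merely bounded by \<open>radius\<close> and \<open>N / t > 1\<close>.\<close>
  define K1 where "K1 = 2 * h\<^sup>2 / \<beta> * (radius + norm (z - c))\<^sup>2 + 2 * D\<^sup>2 / \<beta>"
  define K2 where "K2 = \<beta> / 2 * radius\<^sup>2 * N"
  define K where "K = K1 + K2 + Lip\<^sup>2 / h"
  have N: "N \<ge> 0"
    by (simp add: N_def)
  have K1: "K1 \<ge> 0" and K2: "K2 \<ge> 0"
    using \<beta> N by (auto simp: K1_def K2_def)
  have "loss (s t) (th1 s t) + g (th2 s (Suc t)) - loss (s t) z - g z
      \<le> energy s t - energy s (Suc t) + K / t" if s: "valid s" and t: "t \<ge> 1" for s t
  proof -
    define P where "P = norm (th1 s (Suc t) - th2 s t)"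
    define Q where "Q = norm (th1 s (Suc t) - th1 s t)"
    have i: "s t \<in> {1..n}"
      by (rule validD[OF s t])
    have t0: "real t > 0"
      using t by simp
    have nonneg: "0 \<le> \<beta> * t / 2 * P\<^sup>2" "0 \<le> h * t / 4 * Q\<^sup>2"
      using h \<beta> by auto
    have dual: "\<beta> / 2 * (norm (dual s t))\<^sup>2 \<le> \<beta> * t / 2 * P\<^sup>2 + h * t / 4 * Q\<^sup>2 + (K1 + K2) / t"
    proof (cases "real t \<ge> N")
      case True
      have "norm (th1 s (Suc t) - c) \<le> radius + norm (z - c)"
        using radius_th1[OF s, of "Suc t"] norm_triangle_ineq[of "th1 s (Suc t) - z" "z - c"] by simp
      then have "2 * h\<^sup>2 / \<beta> * (norm (th1 s (Suc t) - c))\<^sup>2 \<le> 2 * h\<^sup>2 / \<beta> * (radius + norm (z - c))\<^sup>2"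
        using \<beta> by (intro mult_left_mono power_mono) auto
      then have "(2 * h\<^sup>2 / \<beta> * (norm (th1 s (Suc t) - c))\<^sup>2 + 2 * D\<^sup>2 / \<beta>) / t\<^sup>2 \<le> K1 / t\<^sup>2"
        by (intro divide_right_mono) (auto simp: K1_def)
      also have "\<dots> \<le> K1 / t"
        using K1 t by (intro divide_left_mono) (auto simp: power2_eq_square)
      also have "\<dots> \<le> (K1 + K2) / t"
        using K2 by (intro divide_right_mono) auto
      finally show ?thesis
        using dual_absorbed[where s = s and t = t, OF i] True
        unfolding P_def Q_def N_def by (simp add: add_divide_distrib)
    next
      case False
      have "\<beta> / 2 * (norm (dual s t))\<^sup>2 \<le> \<beta> / 2 * radius\<^sup>2"
        using \<beta> radius_dual[OF s t] by (intro mult_left_mono power_mono) auto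
      also have "\<dots> \<le> \<beta> / 2 * radius\<^sup>2 * (N / t)"
        using False \<beta> t0 mult_left_mono[of 1 "N / t" "\<beta> / 2 * radius\<^sup>2"] by simp
      also have "\<dots> = K2 / t"
        by (simp add: K2_def)
      also have "\<dots> \<le> (K1 + K2) / t"
        using K1 by (intro divide_right_mono) auto
      finally show ?thesis
        using nonneg by linarith
    qed
    have "loss (s t) (th1 s t) - loss (s t) (th1 s (Suc t)) \<le> Lip * Q"
      using loss_Lipschitz[OF i radius_th1[OF s t] radius_th1[OF s, of "Suc t"]]
      by (simp add: Q_def norm_minus_commute)
    also have "\<dots> \<le> Lip\<^sup>2 / h / t + h * t / 4 * Q\<^sup>2"
    proof -
      \<comment> \<open>The square is balanced so that its \<open>Q\<close> part is exactly the
        unspent half of the proximal term.\<close>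
      have "0 \<le> (Lip - h * t / 2 * Q)\<^sup>2 / (h * t)"
        using h by simp
      also have "\<dots> = Lip\<^sup>2 / h / t + h * t / 4 * Q\<^sup>2 - Lip * Q"
        using h t0 by (simp add: field_simps power2_eq_square)
      finally show ?thesis
        by simp
    qed
    finally have move: "loss (s t) (th1 s t) - loss (s t) (th1 s (Suc t)) \<le> Lip\<^sup>2 / h / t + h * t / 4 * Q\<^sup>2" .
    have "h * t / 2 * Q\<^sup>2 = h * t / 4 * Q\<^sup>2 + h * t / 4 * Q\<^sup>2"
      by simp
    moreover have "K / t = (K1 + K2) / t + Lip\<^sup>2 / h / t"
      by (simp add: K_def add_divide_distrib)
    ultimately show ?thesis
      using energy_step[where s = s and t = t, OF t i] dual move unfolding P_def[symmetric] Q_def[symmetric] by linarith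
  qed
  moreover have "K \<ge> 0"
    using K1 K2 h by (simp add: K_def)
  ultimately show ?thesis
    by blast
qed

lemma regret_bound:
  "\<exists>K\<ge>0::real. \<forall>s. valid s \<longrightarrow> (\<forall>T\<ge>1.
     (\<Sum>t=1..T. loss (s t) (th1 s t) + g (th2 s (Suc t)) - loss (s t) z - g z) \<le> K * (1 + ln T))"
proof -
  obtain K where K: "K \<ge> 0" "\<And>s t. valid s \<Longrightarrow> t \<ge> 1 \<Longrightarrow>
      loss (s t) (th1 s t) + g (th2 s (Suc t)) - loss (s t) z - g z
        \<le> energy s t - energy s (Suc t) + K / t"
    using regret_step by blast
  define K' where "K' = energy (\<lambda>_. 0) 1 + K"
  have "(\<Sum>t=1..T. loss (s t) (th1 s t) + g (th2 s (Suc t)) - loss (s t) z - g z) \<le> K' * (1 + ln T)"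
    if s: "valid s" and T: "T \<ge> 1" for s T
  proof -
    have "(\<Sum>t=1..T. loss (s t) (th1 s t) + g (th2 s (Suc t)) - loss (s t) z - g z)
        \<le> (\<Sum>t=1..T. (energy s t - energy s (Suc t)) + K * (1 / real t))"
      using K(2)[OF s] by (intro sum_mono) auto
    also have "\<dots> = (\<Sum>t=1..T. energy s t - energy s (Suc t)) + K * (\<Sum>t=1..T. 1 / real t)"
      by (simp only: sum.distrib sum_distrib_left)
    also have "(\<Sum>t=1..T. energy s t - energy s (Suc t)) = energy s 1 - energy s (Suc T)"
      using T by (induction T rule: dec_induct) auto
    also have "energy s 1 - energy s (Suc T) + K * (\<Sum>t=1..T. 1 / real t)
        \<le> energy (\<lambda>_. 0) 1 + K * (1 + ln T)"
      using energy_1[of s] energy_nonneg[of "Suc T" s] K(1) sum_inverse_le_ln[OF T]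
      by (intro add_mono mult_left_mono) auto
    also have "\<dots> \<le> K' * (1 + ln T)"
      using energy_nonneg[of 1 "\<lambda>_. 0"] T by (simp add: K'_def algebra_simps)
    finally show ?thesis .
  qed
  moreover have "K' \<ge> 0"
    using K(1) energy_nonneg[of 1 "\<lambda>_. 0"] by (simp add: K'_def)
  ultimately show ?thesis
    by blast
qed

end

subsection \<open>Azuma inequality for uniform samples\<close>

lemma sum_PiE_insert:
  fixes f :: "('a \<Rightarrow> 'b) \<Rightarrow> 'c::comm_monoid_add"
  assumes "x \<notin> S"
  shows "(\<Sum>\<sigma>\<in>Pi\<^sub>E (insert x S) A. f \<sigma>) = (\<Sum>\<sigma>\<in>Pi\<^sub>E S A. \<Sum>y\<in>A x. f (\<sigma>(x := y)))"
proof -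
  have "(\<Sum>\<sigma>\<in>Pi\<^sub>E (insert x S) A. f \<sigma>) = (\<Sum>(y, g)\<in>A x \<times> Pi\<^sub>E S A. f (g(x := y)))"
    unfolding PiE_insert_eq
    by (subst sum.reindex[OF inj_combinator[OF assms]]) (simp add: o_def case_prod_beta)
  also have "\<dots> = (\<Sum>y\<in>A x. \<Sum>g\<in>Pi\<^sub>E S A. f (g(x := y)))"
    by (simp add: sum.cartesian_product)
  finally show ?thesis
    by (subst sum.swap)
qed

text \<open>The finite form of conditioning on the first \<open>T\<close> draws: the inner sum runs
  over the last one.\<close>

lemma sum_PiE_atLeast1_Suc:
  fixes f :: "(nat \<Rightarrow> 'b) \<Rightarrow> 'c::comm_monoid_add"
  shows "(\<Sum>\<sigma>\<in>Pi\<^sub>E {1..Suc T} (\<lambda>_. A). f \<sigma>) = (\<Sum>\<sigma>\<in>Pi\<^sub>E {1..T} (\<lambda>_. A). \<Sum>y\<in>A. f (\<sigma>(Suc T := y)))"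
proof -
  have "{1..Suc T} = insert (Suc T) {1..T}"
    by auto
  then show ?thesis
    by (simp only:) (subst sum_PiE_insert; simp)
qed

text \<open>Hoeffding's lemma for the uniform law, cleared of the factor \<open>1 / n\<close>; the
  interval has length \<open>2 c\<close>, so the exponent \<open>l^2 (2 c)^2 / 8\<close> becomes
  \<open>l^2 c^2 / 2\<close>.\<close>

lemma Hoeffding_uniform_mgf:
  fixes a :: "nat \<Rightarrow> real"
  assumes n: "n \<ge> 1" and l: "l > 0" and zero: "(\<Sum>i=1..n. a i) = 0"
    and bnd: "\<And>i. i \<in> {1..n} \<Longrightarrow> \<bar>a i\<bar> \<le> c"
  shows "(\<Sum>i=1..n. exp (l * a i)) \<le> real n * exp (l\<^sup>2 * c\<^sup>2 / 2)"
proof -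
  have S: "finite {1..n}" "{1..n} \<noteq> {}"
    using n by auto
  let ?p = "measure_pmf (pmf_of_set {1..n})"
  interpret interval_bounded_random_variable ?p a "- c" c
    using S bnd by unfold_locales (auto simp: AE_measure_pmf_iff abs_le_iff minus_le_iff)
  have "integral\<^sup>L ?p a = 0"
    using integral_pmf_of_set[OF S(2,1), of a] zero by simp
  from Hoeffdings_lemma_nn_integral_0[OF l this]
  have "nn_integral ?p (\<lambda>i. exp (l * a i)) \<le> ennreal (exp (l\<^sup>2 * c\<^sup>2 / 2))"
    by (simp add: power2_eq_square mult_ac)
  also have "nn_integral ?p (\<lambda>i. exp (l * a i)) = ennreal ((\<Sum>i=1..n. exp (l * a i)) / real n)"
    using S n by (subst nn_integral_pmf_of_set)
      (auto simp: sum_ennreal divide_ennreal sum_nonneg ennreal_of_nat_eq_real_of_nat)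
  finally have "(\<Sum>i=1..n. exp (l * a i)) / real n \<le> exp (l\<^sup>2 * c\<^sup>2 / 2)"
    by simp
  then show ?thesis
    using n by (simp add: field_simps)
qed

text \<open>Bounded martingale differences in combinatorial form: \<open>X t\<close> reads the first
  \<open>t\<close> coordinates, and summing over the \<open>t\<close>-th one with an admissible past
  fixed gives zero.\<close>

context
  fixes X :: "nat \<Rightarrow> (nat \<Rightarrow> nat) \<Rightarrow> real" and n :: nat and c :: real
  assumes n: "n \<ge> 1"
    and adapted: "\<And>t \<sigma> \<sigma>'. t \<ge> 1 \<Longrightarrow> (\<And>\<tau>. \<tau> \<in> {1..t} \<Longrightarrow> \<sigma> \<tau> = \<sigma>' \<tau>) \<Longrightarrow> X t \<sigma> = X t \<sigma>'"
    and centered: "\<And>t \<sigma>. t \<ge> 1 \<Longrightarrow> (\<And>\<tau>. \<tau> \<in> {1..<t} \<Longrightarrow> \<sigma> \<tau> \<in> {1..n}) \<Longrightarrow>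
      (\<Sum>i=1..n. X t (\<sigma>(t := i))) = 0"
    and bounded: "\<And>t \<sigma>. t \<ge> 1 \<Longrightarrow> (\<And>\<tau>. \<tau> \<in> {1..t} \<Longrightarrow> \<sigma> \<tau> \<in> {1..n}) \<Longrightarrow> \<bar>X t \<sigma>\<bar> \<le> c"
begin

lemma partial_sum_update:
  "(\<Sum>t=1..Suc T. X t (\<sigma>(Suc T := i))) = (\<Sum>t=1..T. X t \<sigma>) + X (Suc T) (\<sigma>(Suc T := i))"
proof -
  have "(\<Sum>t=1..T. X t (\<sigma>(Suc T := i))) = (\<Sum>t=1..T. X t \<sigma>)"
    by (intro sum.cong refl adapted) auto
  then show ?thesis
    by simp
qed

lemma centered_sum_PiE: "(\<Sum>\<sigma>\<in>Pi\<^sub>E {1..T} (\<lambda>_. {1..n}). \<Sum>t=1..T. X t \<sigma>) = 0"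
proof (induction T)
  case (Suc T)
  have "(\<Sum>i=1..n. \<Sum>t=1..Suc T. X t (\<sigma>(Suc T := i))) = real n * (\<Sum>t=1..T. X t \<sigma>)"
    if "\<sigma> \<in> Pi\<^sub>E {1..T} (\<lambda>_. {1..n})" for \<sigma>
  proof -
    have "(\<Sum>i=1..n. X (Suc T) (\<sigma>(Suc T := i))) = 0"
      using that by (intro centered) (auto simp: PiE_iff)
    then show ?thesis
      by (simp only: partial_sum_update sum.distrib) simp
  qed
  then have "(\<Sum>\<sigma>\<in>Pi\<^sub>E {1..Suc T} (\<lambda>_. {1..n}). \<Sum>t=1..Suc T. X t \<sigma>)
      = (\<Sum>\<sigma>\<in>Pi\<^sub>E {1..T} (\<lambda>_. {1..n}). real n * (\<Sum>t=1..T. X t \<sigma>))"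
    unfolding sum_PiE_atLeast1_Suc by (rule sum.cong[OF refl])
  then show ?case
    using Suc by (simp flip: sum_distrib_left)
qed auto

text \<open>Given the first \<open>T\<close> coordinates, the exponential of their partial sum
  factors out, and the last difference contributes one factor bounded by
  \<open>Hoeffding_uniform_mgf\<close>.\<close>

lemma exp_sum_PiE_le:
  assumes l: "l > 0"
  shows "(\<Sum>\<sigma>\<in>Pi\<^sub>E {1..T} (\<lambda>_. {1..n}). exp (l * (\<Sum>t=1..T. X t \<sigma>)))
    \<le> real n ^ T * exp (l\<^sup>2 * c\<^sup>2 / 2 * real T)"
proof (induction T)
  case (Suc T)
  let ?e = "exp (l\<^sup>2 * c\<^sup>2 / 2)"
  have "(\<Sum>\<sigma>\<in>Pi\<^sub>E {1..Suc T} (\<lambda>_. {1..n}). exp (l * (\<Sum>t=1..Suc T. X t \<sigma>)))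
      = (\<Sum>\<sigma>\<in>Pi\<^sub>E {1..T} (\<lambda>_. {1..n}). \<Sum>i=1..n. exp (l * (\<Sum>t=1..Suc T. X t (\<sigma>(Suc T := i)))))"
    by (rule sum_PiE_atLeast1_Suc)
  also have "\<dots> \<le> (\<Sum>\<sigma>\<in>Pi\<^sub>E {1..T} (\<lambda>_. {1..n}). exp (l * (\<Sum>t=1..T. X t \<sigma>)) * (real n * ?e))"
  proof (rule sum_mono)
    fix \<sigma> assume \<sigma>: "\<sigma> \<in> Pi\<^sub>E {1..T} (\<lambda>_. {1..n})"
    have "(\<Sum>i=1..n. exp (l * (\<Sum>t=1..Suc T. X t (\<sigma>(Suc T := i)))))
        = exp (l * (\<Sum>t=1..T. X t \<sigma>)) * (\<Sum>i=1..n. exp (l * X (Suc T) (\<sigma>(Suc T := i))))"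
      by (simp only: partial_sum_update distrib_left exp_add sum_distrib_left)
    also have "(\<Sum>i=1..n. exp (l * X (Suc T) (\<sigma>(Suc T := i)))) \<le> real n * ?e"
      using \<sigma> by (intro Hoeffding_uniform_mgf n l centered bounded) (auto simp: PiE_iff)
    finally show "(\<Sum>i=1..n. exp (l * (\<Sum>t=1..Suc T. X t (\<sigma>(Suc T := i)))))
        \<le> exp (l * (\<Sum>t=1..T. X t \<sigma>)) * (real n * ?e)"
      by simp
  qed
  also have "\<dots> = (\<Sum>\<sigma>\<in>Pi\<^sub>E {1..T} (\<lambda>_. {1..n}). exp (l * (\<Sum>t=1..T. X t \<sigma>))) * (real n * ?e)"
    by (simp add: sum_distrib_right)
  also have "\<dots> \<le> real n ^ T * exp (l\<^sup>2 * c\<^sup>2 / 2 * real T) * (real n * ?e)"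
    using Suc by (intro mult_right_mono) auto
  also have "\<dots> = real n ^ Suc T * exp (l\<^sup>2 * c\<^sup>2 / 2 * real (Suc T))"
    by (simp add: distrib_left exp_add)
  finally show ?case .
qed auto

end

section \<open>Expectations under independent uniform draws\<close>

locale uniform_samples = prob_space +
  fixes idx :: "nat \<Rightarrow> 'a \<Rightarrow> nat" and n :: nat
  assumes n: "n \<ge> 1"
    and indep: "indep_vars (\<lambda>_. count_space {1..n}) idx {1..}"
    and uniform: "\<And>t. t \<ge> 1 \<Longrightarrow>
      distr M (count_space {1..n}) (idx t) = uniform_count_measure {1..n}"
begin

lemma idx_measurable: "t \<ge> 1 \<Longrightarrow> idx t \<in> measurable M (count_space {1..n})"
  using indep by (auto simp: indep_vars_def)

lemma idx_range: "t \<ge> 1 \<Longrightarrow> \<omega> \<in> space M \<Longrightarrow> idx t \<omega> \<in> {1..n}"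
  using measurable_space[OF idx_measurable] by auto

lemma prob_idx_eq:
  assumes "t \<ge> 1" "i \<in> {1..n}"
  shows "prob (idx t -` {i} \<inter> space M) = 1 / real n"
proof -
  have "prob (idx t -` {i} \<inter> space M) = measure (distr M (count_space {1..n}) (idx t)) {i}"
    using assms by (subst measure_distr[OF idx_measurable]) auto
  also have "\<dots> = 1 / real n"
    using assms by (subst uniform) (auto simp: measure_uniform_count_measure)
  finally show ?thesis .
qed

lemma prob_prefix:
  assumes T: "T \<ge> 1" and \<sigma>: "\<sigma> \<in> Pi\<^sub>E {1..T} (\<lambda>_. {1..n})"
  shows "{\<omega>\<in>space M. \<forall>t\<in>{1..T}. idx t \<omega> = \<sigma> t} \<in> events"
    and "prob {\<omega>\<in>space M. \<forall>t\<in>{1..T}. idx t \<omega> = \<sigma> t} = 1 / real n ^ T"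
proof -
  have eq: "{\<omega>\<in>space M. \<forall>t\<in>{1..T}. idx t \<omega> = \<sigma> t} = (\<Inter>t\<in>{1..T}. idx t -` {\<sigma> t} \<inter> space M)"
    using T by auto
  have mem: "\<sigma> t \<in> {1..n}" if "t \<in> {1..T}" for t
    using \<sigma> that by (rule PiE_mem)
  show "{\<omega>\<in>space M. \<forall>t\<in>{1..T}. idx t \<omega> = \<sigma> t} \<in> events"
    unfolding eq using T mem
    by (intro sets.finite_INT) (auto intro!: measurable_sets[OF idx_measurable])
  have "prob (\<Inter>t\<in>{1..T}. idx t -` {\<sigma> t} \<inter> space M) = (\<Prod>t\<in>{1..T}. prob (idx t -` {\<sigma> t} \<inter> space M))"
    using T mem by (intro indep_varsD[OF indep]) auto
  also have "\<dots> = (\<Prod>t\<in>{1..T}. 1 / real n)"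
    using mem by (intro prod.cong refl prob_idx_eq) auto
  finally show "prob {\<omega>\<in>space M. \<forall>t\<in>{1..T}. idx t \<omega> = \<sigma> t} = 1 / real n ^ T"
    unfolding eq by (simp add: power_divide)
qed

text \<open>The cylinders fixing the first \<open>T\<close> draws partition the space into finitely
  many events of equal probability, and \<Phi> is constant on each. This yields measurability even
  for functions built from \<open>arg_min\<close>.\<close>

lemma
  fixes \<Phi> :: "(nat \<Rightarrow> nat) \<Rightarrow> real"
  assumes T: "T \<ge> 1"
    and local: "\<And>s s'. (\<And>t. t \<in> {1..T} \<Longrightarrow> s t = s' t) \<Longrightarrow> \<Phi> s = \<Phi> s'"
  shows integrable_prefix_function: "integrable M (\<lambda>\<omega>. \<Phi> (\<lambda>t. idx t \<omega>))"
    and expectation_prefix_function: "expectation (\<lambda>\<omega>. \<Phi> (\<lambda>t. idx t \<omega>))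
      = (\<Sum>\<sigma>\<in>Pi\<^sub>E {1..T} (\<lambda>_. {1..n}). \<Phi> \<sigma>) / real n ^ T"
proof -
  let ?S = "Pi\<^sub>E {1..T} (\<lambda>_. {1..n})"
  define A where "A \<sigma> = {\<omega>\<in>space M. \<forall>t\<in>{1..T}. idx t \<omega> = \<sigma> t}" for \<sigma>
  have fin: "finite ?S"
    by (intro finite_PiE) auto
  have eq: "\<Phi> (\<lambda>t. idx t \<omega>) = (\<Sum>\<sigma>\<in>?S. \<Phi> \<sigma> * indicator (A \<sigma>) \<omega>)" if \<omega>: "\<omega> \<in> space M" for \<omega>
  proof -
    \<comment> \<open>Elements of \<open>Pi\<^sub>E\<close> are \<open>undefined\<close> outside the
      prefix; restricting the observed sequence makes it the only tuple whose cylinder contains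
      \<omega>.\<close>
    define s where "s = restrict (\<lambda>t. idx t \<omega>) {1..T}"
    have s: "s \<in> ?S"
      using idx_range[OF _ \<omega>] by (auto simp: s_def)
    have "\<omega> \<in> A \<sigma> \<longleftrightarrow> \<sigma> = s" if "\<sigma> \<in> ?S" for \<sigma>
      using that \<omega> by (auto simp: A_def s_def PiE_iff extensional_def fun_eq_iff)
    then have "(\<Sum>\<sigma>\<in>?S. \<Phi> \<sigma> * indicator (A \<sigma>) \<omega>) = (\<Sum>\<sigma>\<in>?S. if \<sigma> = s then \<Phi> \<sigma> else 0)"
      by (intro sum.cong) (auto simp: indicator_def)
    also have "\<dots> = \<Phi> s"
      using fin s by simp
    also have "\<dots> = \<Phi> (\<lambda>t. idx t \<omega>)"
      by (intro local) (simp add: s_def)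
    finally show ?thesis ..
  qed
  have int: "integrable M (\<lambda>\<omega>. \<Phi> \<sigma> * indicator (A \<sigma>) \<omega>)" if "\<sigma> \<in> ?S" for \<sigma>
  proof -
    have "A \<sigma> \<in> events"
      using prob_prefix(1)[OF T that] by (simp add: A_def)
    then show ?thesis
      by (intro integrable_mult_right integrable_real_indicator) (auto simp: less_top[symmetric])
  qed
  show "integrable M (\<lambda>\<omega>. \<Phi> (\<lambda>t. idx t \<omega>))"
  proof (rule iffD2[OF Bochner_Integration.integrable_cong[OF refl eq]])
    show "integrable M (\<lambda>\<omega>. \<Sum>\<sigma>\<in>?S. \<Phi> \<sigma> * indicator (A \<sigma>) \<omega>)"
      by (rule Bochner_Integration.integrable_sum) (rule int)
  qed
  have "expectation (\<lambda>\<omega>. \<Phi> (\<lambda>t. idx t \<omega>)) = expectation (\<lambda>\<omega>. \<Sum>\<sigma>\<in>?S. \<Phi> \<sigma> * indicator (A \<sigma>) \<omega>)"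
    by (rule Bochner_Integration.integral_cong[OF refl eq])
  also have "\<dots> = (\<Sum>\<sigma>\<in>?S. expectation (\<lambda>\<omega>. \<Phi> \<sigma> * indicator (A \<sigma>) \<omega>))"
    by (intro Bochner_Integration.integral_sum int)
  also have "\<dots> = (\<Sum>\<sigma>\<in>?S. \<Phi> \<sigma> / real n ^ T)"
  proof (rule sum.cong[OF refl])
    fix \<sigma> assume "\<sigma> \<in> ?S"
    from prob_prefix[OF T this] have "A \<sigma> \<in> events" "prob (A \<sigma>) = 1 / real n ^ T"
      by (simp_all add: A_def)
    then show "expectation (\<lambda>\<omega>. \<Phi> \<sigma> * indicator (A \<sigma>) \<omega>) = \<Phi> \<sigma> / real n ^ T"
      by simp
  qed
  finally show "expectation (\<lambda>\<omega>. \<Phi> (\<lambda>t. idx t \<omega>)) = (\<Sum>\<sigma>\<in>?S. \<Phi> \<sigma>) / real n ^ T"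
    by (simp add: sum_divide_distrib)
qed

lemma
  fixes X :: "nat \<Rightarrow> (nat \<Rightarrow> nat) \<Rightarrow> real" and c :: real
  assumes adapted: "\<And>t \<sigma> \<sigma>'. t \<ge> 1 \<Longrightarrow> (\<And>\<tau>. \<tau> \<in> {1..t} \<Longrightarrow> \<sigma> \<tau> = \<sigma>' \<tau>) \<Longrightarrow> X t \<sigma> = X t \<sigma>'"
    and centered: "\<And>t \<sigma>. t \<ge> 1 \<Longrightarrow> (\<And>\<tau>. \<tau> \<in> {1..<t} \<Longrightarrow> \<sigma> \<tau> \<in> {1..n}) \<Longrightarrow>
      (\<Sum>i=1..n. X t (\<sigma>(t := i))) = 0"
    and bounded: "\<And>t \<sigma>. t \<ge> 1 \<Longrightarrow> (\<And>\<tau>. \<tau> \<in> {1..t} \<Longrightarrow> \<sigma> \<tau> \<in> {1..n}) \<Longrightarrow> \<bar>X t \<sigma>\<bar> \<le> c"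
    and T: "T \<ge> 1"
  shows integrable_martingale: "integrable M (\<lambda>\<omega>. \<Sum>t=1..T. X t (\<lambda>t. idx t \<omega>))"
    and expectation_martingale: "expectation (\<lambda>\<omega>. \<Sum>t=1..T. X t (\<lambda>t. idx t \<omega>)) = 0"
    and Azuma_uniform: "c > 0 \<Longrightarrow> \<epsilon> > 0 \<Longrightarrow>
      prob {\<omega>\<in>space M. \<epsilon> \<le> (\<Sum>t=1..T. X t (\<lambda>t. idx t \<omega>))} \<le> exp (- (\<epsilon>\<^sup>2 / (2 * c\<^sup>2 * real T)))"
proof -
  have loc: "(\<Sum>t=1..T. X t s) = (\<Sum>t=1..T. X t s')"
    if "\<And>t. t \<in> {1..T} \<Longrightarrow> s t = s' t" for s s'
    using that by (intro sum.cong refl adapted) auto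
  show int: "integrable M (\<lambda>\<omega>. \<Sum>t=1..T. X t (\<lambda>t. idx t \<omega>))"
    by (rule integrable_prefix_function[OF T loc])
  show "expectation (\<lambda>\<omega>. \<Sum>t=1..T. X t (\<lambda>t. idx t \<omega>)) = 0"
    using centered_sum_PiE[of n X c, OF n adapted centered bounded]
    by (subst expectation_prefix_function[OF T, where \<Phi> = "\<lambda>s. \<Sum>t=1..T. X t s", OF loc]) auto
  assume c: "c > 0" and \<epsilon>: "\<epsilon> > 0"
  \<comment> \<open>Minimizer of the Chernoff exponent
    \<open>l^2 c^2 T / 2 - l \<epsilon>\<close>.\<close>
  define l where "l = \<epsilon> / (c\<^sup>2 * real T)"
  have l: "l > 0"
    using c \<epsilon> T by (simp add: l_def)
  have loc': "exp (l * (\<Sum>t=1..T. X t s)) = exp (l * (\<Sum>t=1..T. X t s'))"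
    if "\<And>t. t \<in> {1..T} \<Longrightarrow> s t = s' t" for s s'
    using loc[OF that] by simp
  have int': "integrable M (\<lambda>\<omega>. exp (l * (\<Sum>t=1..T. X t (\<lambda>t. idx t \<omega>))))"
    by (rule integrable_prefix_function[OF T loc'])
  have "expectation (\<lambda>\<omega>. exp (l * (\<Sum>t=1..T. X t (\<lambda>t. idx t \<omega>)))) \<le> exp (l\<^sup>2 * c\<^sup>2 / 2 * real T)"
  proof -
    have "(\<Sum>\<sigma>\<in>Pi\<^sub>E {1..T} (\<lambda>_. {1..n}). exp (l * (\<Sum>t=1..T. X t \<sigma>)))
        \<le> real n ^ T * exp (l\<^sup>2 * c\<^sup>2 / 2 * real T)"
      by (rule exp_sum_PiE_le[OF n adapted centered bounded l])
    then show ?thesis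
      using n by (subst expectation_prefix_function[OF T loc']) (auto simp: field_simps)
  qed
  have "prob {\<omega>\<in>space M. \<epsilon> \<le> (\<Sum>t=1..T. X t (\<lambda>t. idx t \<omega>))}
      = prob {\<omega>\<in>space M. exp (l * \<epsilon>) \<le> exp (l * (\<Sum>t=1..T. X t (\<lambda>t. idx t \<omega>)))}"
    using l by simp
  also have "\<dots> \<le> expectation (\<lambda>\<omega>. exp (l * (\<Sum>t=1..T. X t (\<lambda>t. idx t \<omega>)))) / exp (l * \<epsilon>)"
    by (rule integral_Markov_inequality_measure[where A = "{}", simplified]) (use int' in auto)
  also have "\<dots> \<le> exp (l\<^sup>2 * c\<^sup>2 / 2 * real T) / exp (l * \<epsilon>)"
    by (intro divide_right_mono less_imp_le[OF exp_gt_zero]) fact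
  also have "\<dots> = exp (l\<^sup>2 * c\<^sup>2 / 2 * real T - l * \<epsilon>)"
    by (simp add: exp_diff)
  also have "l\<^sup>2 * c\<^sup>2 / 2 * real T - l * \<epsilon> = - (\<epsilon>\<^sup>2 / (2 * c\<^sup>2 * real T))"
    using c T by (simp add: l_def field_simps power2_eq_square)
  finally show "prob {\<omega>\<in>space M. \<epsilon> \<le> (\<Sum>t=1..T. X t (\<lambda>t. idx t \<omega>))}
      \<le> exp (- (\<epsilon>\<^sup>2 / (2 * c\<^sup>2 * real T)))" .
qed

end

subsection \<open>Averages, residual and sampling noise\<close>

text \<open>The half-open range matters: the draw at time \<open>t\<close> first influences iterate
  \<open>t + 1\<close>. This is what makes \<open>noise\<close> centered.\<close>

lemma sadm_cong:
  assumes "\<And>\<tau>. \<tau> \<in> {1..<t} \<Longrightarrow> s \<tau> = s' \<tau>"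
  shows "sadm L G \<rho> \<gamma> s t = sadm L G \<rho> \<gamma> s' t"
  using assms
proof (induction t)
  case (Suc t)
  then have "sadm L G \<rho> \<gamma> s t = sadm L G \<rho> \<gamma> s' t"
    by simp
  moreover have "t \<noteq> 0 \<Longrightarrow> s t = s' t"
    using Suc.prems by simp
  ultimately show ?case
    by simp
qed simp

text \<open>The origin of the threshold 3: it is at least e, so bounded terms can be absorbed into
  the logarithm.\<close>

lemma ln_ge_1: "T \<ge> 3 \<Longrightarrow> 1 \<le> ln (real T)"
  using exp_le by (subst ln_ge_iff) auto

context sadm_problem
begin

lemma
  assumes "\<And>\<tau>. \<tau> \<in> {1..<t} \<Longrightarrow> s \<tau> = s' \<tau>"
  shows th1_cong: "th1 s t = th1 s' t" and th2_cong: "th2 s t = th2 s' t"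
  by (simp_all only: th1_def th2_def theta1_def theta2_def sadm_cong[of t s s', OF assms])

definition avg1 :: "(nat \<Rightarrow> nat) \<Rightarrow> nat \<Rightarrow> 'a" where
  "avg1 = theta1_avg loss reg (\<lambda>t. \<beta> * real t) (\<lambda>t. h * real t)"

definition avg2 :: "(nat \<Rightarrow> nat) \<Rightarrow> nat \<Rightarrow> 'a" where
  "avg2 = theta2_avg loss reg (\<lambda>t. \<beta> * real t) (\<lambda>t. h * real t)"

lemma avg1_eq: "avg1 s T = (\<Sum>t=1..T. (1 / real T) *\<^sub>R th1 s t)"
  by (simp add: avg1_def theta1_avg_def th1_def scaleR_sum_right)

lemma avg2_eq: "avg2 s T = (\<Sum>t=1..T. (1 / real T) *\<^sub>R th2 s (Suc t))"
  by (simp add: avg2_def theta2_avg_def th2_def scaleR_sum_right)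

lemma th2_in_C: "valid s \<Longrightarrow> t \<ge> 1 \<Longrightarrow> th2 s (Suc t) \<in> C"
  using sadm_step(2)[where s = s and t = t] validD by blast

lemma avg1_radius:
  assumes s: "valid s" and T: "T \<ge> 1"
  shows "norm (avg1 s T - z) \<le> radius"
proof -
  have "avg1 s T \<in> cball z radius"
    unfolding avg1_eq using T radius_th1[OF s]
    by (intro convex_sum) (auto simp: dist_norm norm_minus_commute)
  then show ?thesis
    by (simp add: dist_norm norm_minus_commute)
qed

lemma avg2_in_C:
  assumes s: "valid s" and T: "T \<ge> 1"
  shows "avg2 s T \<in> C"
proof -
  have "convex C"
    using g_strongly_convex by (simp add: strongly_convex_on_def)
  then show ?thesis
    unfolding avg2_eq using T th2_in_C[OF s] by (intro convex_sum) auto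
qed

text \<open>The scaled dual variable accumulates the primal residuals without any rescaling, so the gap of
  the averages telescopes to a bounded quantity over \<open>T\<close>.\<close>

lemma avg_gap:
  assumes s: "valid s" and T: "T \<ge> 1"
  shows "norm (avg1 s T - avg2 s T) \<le> 3 * radius / T"
proof -
  \<comment> \<open>The averages are shifted against each other by one index, which leaves the first
    and last iterates besides the accumulated dual.\<close>
  have "(\<Sum>t=1..T. th1 s t - th2 s (Suc t)) = dual s (Suc T) + th1 s 1 - th1 s (Suc T)"
    using T
  proof (induction T rule: dec_induct)
    case base
    then show ?case
      using sadm_step(4)[where s = s and t = 1] validD[OF s, of 1] initial(3) by simp
  next
    case (step T)
    then show ?case
      using sadm_step(4)[where s = s and t = "Suc T"] validD[OF s, of "Suc T"] by simp
  qed
  \<comment> \<open>Inserting \<open>z\<close> twice leaves three vectors, each of norm at most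
    \<open>radius\<close>.\<close>
  then have "avg1 s T - avg2 s T = (1 / real T) *\<^sub>R (dual s (Suc T) + (th1 s 1 - z) - (th1 s (Suc T) - z))"
    unfolding avg1_eq avg2_eq by (simp add: sum_subtractf flip: scaleR_sum_right scaleR_diff_right)
  moreover have "norm (dual s (Suc T) + (th1 s 1 - z) - (th1 s (Suc T) - z)) \<le> 3 * radius"
    using radius_dual[OF s, of "Suc T"] radius_th1[OF s, of 1] radius_th1[OF s, of "Suc T"]
      norm_triangle_ineq[of "dual s (Suc T)" "th1 s 1 - z"]
      norm_triangle_ineq4[of "dual s (Suc T) + (th1 s 1 - z)" "th1 s (Suc T) - z"]
    by linarith
  ultimately show ?thesis
    using T by (simp add: divide_right_mono)
qed

lemma loss_convex:
  assumes i: "i \<in> {1..n}"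
  shows "convex_on UNIV (loss i)"
proof (rule convex_onI)
  fix t :: real and y w :: 'a assume t: "0 < t" "t < 1"
  have "(1 - t) *\<^sub>R y + t *\<^sub>R w - c = (1 - t) *\<^sub>R (y - c) + t *\<^sub>R (w - c)"
    by (simp add: algebra_simps)
  then have "(norm ((1 - t) *\<^sub>R y + t *\<^sub>R w - c))\<^sup>2 \<le> (1 - t) * (norm (y - c))\<^sup>2 + t * (norm (w - c))\<^sup>2"
    using t by (simp add: norm_sq_convex_combination)
  then have "h / 2 * (norm ((1 - t) *\<^sub>R y + t *\<^sub>R w - c))\<^sup>2
      \<le> h / 2 * ((1 - t) * (norm (y - c))\<^sup>2 + t * (norm (w - c))\<^sup>2)"
    using h by (intro mult_left_mono) auto
  moreover have "\<phi> i ((1 - t) *\<^sub>R y + t *\<^sub>R w) \<le> (1 - t) * \<phi> i y + t * \<phi> i w"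
    using convex_onD[OF \<phi>_convex[OF i], of t y w] t by simp
  ultimately show "loss i ((1 - t) *\<^sub>R y + t *\<^sub>R w) \<le> (1 - t) * loss i y + t * loss i w"
    unfolding loss_def by (simp add: algebra_simps add_divide_distrib diff_divide_distrib)
qed auto

lemma g_convex_on: "convex_on C g"
proof (rule convex_onI)
  show "g ((1 - t) *\<^sub>R y + t *\<^sub>R w) \<le> (1 - t) * g y + t * g w"
    if "0 < t" "t < 1" "y \<in> C" "w \<in> C" for t y w
  proof -
    have "0 \<le> \<beta> / 2 * (t * (1 - t)) * (norm (y - w))\<^sup>2"
      using \<beta> that by simp
    moreover have "g ((1 - t) *\<^sub>R y + t *\<^sub>R w)
        \<le> (1 - t) * g y + t * g w - \<beta> / 2 * (t * (1 - t)) * (norm (y - w))\<^sup>2"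
      using g_strongly_convex that by (auto simp: strongly_convex_on_def)
    ultimately show ?thesis
      by linarith
  qed
qed (use g_strongly_convex in \<open>simp add: strongly_convex_on_def\<close>)

definition mean_loss :: "'a \<Rightarrow> real" where
  "mean_loss = avg_loss n loss"

lemma mean_loss_sum: "real n * mean_loss y = (\<Sum>i=1..n. loss i y)"
  using n by (simp add: mean_loss_def avg_loss_def)

lemma mean_loss_Lipschitz:
  assumes "norm (y - z) \<le> radius" "norm (w - z) \<le> radius"
  shows "\<bar>mean_loss y - mean_loss w\<bar> \<le> Lip * norm (y - w)"
proof -
  have "real n * \<bar>mean_loss y - mean_loss w\<bar> = \<bar>real n * (mean_loss y - mean_loss w)\<bar>"
    by (simp add: abs_mult)
  also have "\<dots> = \<bar>\<Sum>i=1..n. loss i y - loss i w\<bar>"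
    by (simp only: right_diff_distrib mean_loss_sum sum_subtractf)
  also have "\<dots> \<le> (\<Sum>i=1..n. Lip * norm (y - w))"
    using loss_Lipschitz[OF _ assms] by (intro sum_abs[THEN order_trans] sum_mono)
  finally show ?thesis
    using n by simp
qed

definition res :: "(nat \<Rightarrow> nat) \<Rightarrow> nat \<Rightarrow> real" where
  "res s T = mean_loss (avg1 s T) + g (avg2 s T) - mean_loss z - g z"

text \<open>Averages of points of the convex set \<open>C\<close> stay in \<open>C\<close>, so both
  indicator values vanish and the extended reals disappear.\<close>

lemma residual_eq:
  assumes "valid s" "T \<ge> 1"
  shows "residual n loss reg (\<lambda>t. \<beta> * real t) (\<lambda>t. h * real t) z s T = ereal (res s T)"
  using avg2_in_C[OF assms] z
  by (simp add: residual_def res_def mean_loss_def avg1_def avg2_def reg_def chi_def)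

lemma res_cong:
  assumes "\<And>t. t \<in> {1..T} \<Longrightarrow> s t = s' t"
  shows "res s T = res s' T"
proof -
  have "th1 s t = th1 s' t" "th2 s (Suc t) = th2 s' (Suc t)" if "t \<in> {1..T}" for t
    using assms that by (auto intro!: th1_cong th2_cong)
  then have "avg1 s T = avg1 s' T" "avg2 s T = avg2 s' T"
    by (auto simp: avg1_eq avg2_eq intro!: sum.cong)
  then show ?thesis
    by (simp add: res_def)
qed

text \<open>True minus sampled regret at an iterate fixed before the draw; subtracting the values at
  \<open>z\<close> makes it bounded through \<open>Lip\<close>.\<close>

definition noise :: "nat \<Rightarrow> (nat \<Rightarrow> nat) \<Rightarrow> real" where
  "noise t s = (mean_loss (th1 s t) - mean_loss z) - (loss (s t) (th1 s t) - loss (s t) z)"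

lemma noise_adapted:
  assumes "t \<ge> 1" "\<And>\<tau>. \<tau> \<in> {1..t} \<Longrightarrow> s \<tau> = s' \<tau>"
  shows "noise t s = noise t s'"
proof -
  have "th1 s t = th1 s' t" "s t = s' t"
    using assms by (auto intro!: th1_cong)
  then show ?thesis
    by (simp add: noise_def)
qed

lemma noise_centered: "(\<Sum>i=1..n. noise t (s(t := i))) = 0"
proof -
  have "th1 (s(t := i)) t = th1 s t" for i
    by (rule th1_cong) auto
  then have "(\<Sum>i=1..n. noise t (s(t := i)))
      = (\<Sum>i=1..n. (mean_loss (th1 s t) - mean_loss z) - (loss i (th1 s t) - loss i z))"
    by (simp add: noise_def)
  also have "\<dots> = real n * (mean_loss (th1 s t) - mean_loss z)
      - ((\<Sum>i=1..n. loss i (th1 s t)) - (\<Sum>i=1..n. loss i z))"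
    by (simp add: sum_subtractf)
  also have "\<dots> = 0"
    by (simp only: right_diff_distrib mean_loss_sum)
  finally show ?thesis .
qed

lemma noise_bounded:
  assumes t: "t \<ge> 1" and s: "\<And>\<tau>. \<tau> \<in> {1..t} \<Longrightarrow> s \<tau> \<in> {1..n}"
  shows "\<bar>noise t s\<bar> \<le> 2 * Lip * radius"
proof -
  \<comment> \<open>The radius bound requires a sequence valid at all positive times; later draws
    are filled with index 1 and do not affect \<open>noise t\<close>.\<close>
  define s' where "s' = (\<lambda>\<tau>. if \<tau> \<le> t then s \<tau> else 1)"
  have s': "valid s'"
    using s n by (auto simp: valid_def s'_def)
  define y where "y = th1 s' t"
  have y: "norm (y - z) \<le> radius"
    unfolding y_def by (rule radius_th1[OF s' t])
  then have "Lip * norm (y - z) \<le> Lip * radius"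
    using Lip_nonneg by (intro mult_left_mono)
  moreover have "\<bar>mean_loss y - mean_loss z\<bar> \<le> Lip * norm (y - z)"
    using y radius_nonneg by (intro mean_loss_Lipschitz) auto
  moreover have "\<bar>loss (s' t) y - loss (s' t) z\<bar> \<le> Lip * norm (y - z)"
    using y radius_nonneg by (intro loss_Lipschitz validD[OF s' t]) auto
  ultimately have "\<bar>noise t s'\<bar> \<le> 2 * Lip * radius"
    unfolding noise_def y_def[symmetric] by linarith
  moreover have "noise t s = noise t s'"
    by (rule noise_adapted[OF t]) (simp add: s'_def)
  ultimately show ?thesis
    by simp
qed

text \<open>Jensen's inequality for both averages bounds the residual by the mean regret, and
  \<open>noise\<close> is by construction the difference from the sampled regret.\<close>

lemma res_le_noise:
  "\<exists>K\<ge>0::real. \<forall>s. valid s \<longrightarrow> (\<forall>T\<ge>1. T * res s T \<le> K * (1 + ln T) + (\<Sum>t=1..T. noise t s))"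
proof -
  obtain K :: real where K: "K \<ge> 0" "\<And>s T. valid s \<Longrightarrow> T \<ge> 1 \<Longrightarrow>
      (\<Sum>t=1..T. loss (s t) (th1 s t) + g (th2 s (Suc t)) - loss (s t) z - g z) \<le> K * (1 + ln T)"
    using regret_bound by blast
  have "T * res s T \<le> K * (1 + ln T) + (\<Sum>t=1..T. noise t s)" if s: "valid s" and T: "T \<ge> 1" for s T
  proof -
    have fin: "finite {1..T}" "{1..T} \<noteq> {}"
      using T by auto
    have "loss i (avg1 s T) \<le> (\<Sum>t=1..T. (1 / real T) * loss i (th1 s t))" if "i \<in> {1..n}" for i
      unfolding avg1_eq by (rule convex_on_sum[OF fin loss_convex[OF that]]) (use T in auto)
    then have "real n * mean_loss (avg1 s T) \<le> (\<Sum>i=1..n. \<Sum>t=1..T. (1 / real T) * loss i (th1 s t))"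
      unfolding mean_loss_sum by (rule sum_mono)
    also have "\<dots> = (\<Sum>t=1..T. (1 / real T) * (real n * mean_loss (th1 s t)))"
      unfolding mean_loss_sum sum_distrib_left by (rule sum.swap)
    also have "\<dots> = real n * ((\<Sum>t=1..T. mean_loss (th1 s t)) / real T)"
      by (simp add: sum_divide_distrib sum_distrib_left)
    finally have m: "real T * mean_loss (avg1 s T) \<le> (\<Sum>t=1..T. mean_loss (th1 s t))"
      using n T by (simp add: pos_le_divide_eq mult.commute)
    have "g (avg2 s T) \<le> (\<Sum>t=1..T. (1 / real T) * g (th2 s (Suc t)))"
      unfolding avg2_eq by (rule convex_on_sum[OF fin g_convex_on]) (use T th2_in_C[OF s] in auto)
    also have "\<dots> = (\<Sum>t=1..T. g (th2 s (Suc t))) / real T"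
      by (simp add: sum_divide_distrib)
    finally have gm: "real T * g (avg2 s T) \<le> (\<Sum>t=1..T. g (th2 s (Suc t)))"
      using T by (simp add: pos_le_divide_eq mult.commute)
    have "T * res s T = real T * mean_loss (avg1 s T) + real T * g (avg2 s T) - real T * mean_loss z - real T * g z"
      by (simp add: res_def algebra_simps)
    also have "\<dots> \<le> (\<Sum>t=1..T. mean_loss (th1 s t)) + (\<Sum>t=1..T. g (th2 s (Suc t)))
        - real T * mean_loss z - real T * g z"
      using m gm by linarith
    also have "\<dots> = (\<Sum>t=1..T. mean_loss (th1 s t) + g (th2 s (Suc t)) - mean_loss z - g z)"
      by (simp add: sum.distrib sum_subtractf)
    also have "\<dots> = (\<Sum>t=1..T. (loss (s t) (th1 s t) + g (th2 s (Suc t)) - loss (s t) z - g z) + noise t s)"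
      by (intro sum.cong refl) (simp add: noise_def)
    also have "\<dots> \<le> K * (1 + ln T) + (\<Sum>t=1..T. noise t s)"
      unfolding sum.distrib using K(2)[OF s T] by simp
    finally show ?thesis .
  qed
  then show ?thesis
    using K(1) by blast
qed

text \<open>Minimality applies only at a common point for both blocks. The loss is moved from
  \<open>avg1\<close> to the feasible point \<open>avg2\<close> at the price of \<open>Lip\<close>
  times the gap.\<close>

lemma res_lower:
  assumes opt: "\<And>y. y \<in> C \<Longrightarrow> mean_loss z + g z \<le> mean_loss y + g y"
    and s: "valid s" and T: "T \<ge> 1"
  shows "- (3 * Lip * radius / T) \<le> res s T"
proof -
  have "\<bar>mean_loss (avg1 s T) - mean_loss (avg2 s T)\<bar> \<le> Lip * norm (avg1 s T - avg2 s T)"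
    by (intro mean_loss_Lipschitz avg1_radius radius_C avg2_in_C s T)
  also have "\<dots> \<le> Lip * (3 * radius / T)"
    by (intro mult_left_mono avg_gap s T Lip_nonneg)
  finally have "\<bar>mean_loss (avg1 s T) - mean_loss (avg2 s T)\<bar> \<le> 3 * Lip * radius / T"
    by (simp add: mult.left_commute)
  then show ?thesis
    using opt[OF avg2_in_C[OF s T]] by (simp add: res_def)
qed

text \<open>The squared gap is of order \<open>1 / T^2\<close>; the stated rate follows from
  \<open>1 / T \<le> 1 \<le> ln T\<close>.\<close>

lemma gap_rate:
  "\<exists>K. \<forall>\<^sub>F T in sequentially. \<forall>s. valid s \<longrightarrow> (norm (avg1 s T - avg2 s T))\<^sup>2 \<le> K * (ln (real T) / real T)"
proof (intro exI eventually_mono[OF eventually_ge_at_top[of 3]] allI impI)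
  fix T :: nat and s assume T: "3 \<le> T" and s: "valid s"
  have "(norm (avg1 s T - avg2 s T))\<^sup>2 \<le> (3 * radius / T)\<^sup>2"
    using avg_gap[OF s, of T] T by (intro power_mono) auto
  also have "\<dots> = (3 * radius)\<^sup>2 * (1 / real T / real T)"
    by (simp add: power2_eq_square)
  also have "\<dots> \<le> (3 * radius)\<^sup>2 * (ln (real T) / real T)"
    using ln_ge_1[OF T] T
    by (intro mult_left_mono divide_right_mono) (auto intro: order_trans[of _ 1])
  finally show "(norm (avg1 s T - avg2 s T))\<^sup>2 \<le> (3 * radius)\<^sup>2 * (ln (real T) / real T)" .
qed

section \<open>Expectation and tail of the residual\<close>

context
  fixes M :: "'w measure" and idx :: "nat \<Rightarrow> 'w \<Rightarrow> nat"
  assumes samples: "uniform_samples M idx n"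
begin

interpretation uniform_samples M idx n
  by (rule samples)

lemma valid_samples: "\<omega> \<in> space M \<Longrightarrow> valid (\<lambda>t. idx t \<omega>)"
  using idx_range by (simp add: valid_def)

lemma integrable_res: "T \<ge> 1 \<Longrightarrow> integrable M (\<lambda>\<omega>. res (\<lambda>t. idx t \<omega>) T)"
  by (rule integrable_prefix_function[where \<Phi> = "\<lambda>s. res s T"]) (auto intro: res_cong)

lemma expectation_rate:
  assumes opt: "\<And>y. y \<in> C \<Longrightarrow> mean_loss z + g z \<le> mean_loss y + g y"
  shows "(\<lambda>T. integral\<^sup>L M (\<lambda>\<omega>. res (\<lambda>t. idx t \<omega>) T)) \<in> O(\<lambda>T. ln (real T) / real T)"
proof -
  obtain K :: real where K: "K \<ge> 0"
    "\<And>s T. valid s \<Longrightarrow> T \<ge> 1 \<Longrightarrow> T * res s T \<le> K * (1 + ln T) + (\<Sum>t=1..T. noise t s)"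
    using res_le_noise by blast
  \<comment> \<open>\<open>2 K\<close> comes from \<open>1 + ln T \<le> 2 ln T\<close> in the upper
    bound, the other summand from \<open>res_lower\<close>.\<close>
  define K' where "K' = 2 * K + 3 * Lip * radius"
  have "\<bar>integral\<^sup>L M (\<lambda>\<omega>. res (\<lambda>t. idx t \<omega>) T)\<bar> \<le> K' * (ln (real T) / real T)" if T: "T \<ge> 3" for T
  proof -
    have T1: "T \<ge> 1" and T0: "real T > 0"
      using T by auto
    note int = integrable_res[OF T1]
    note intn = integrable_martingale[of noise "2 * Lip * radius",
        OF noise_adapted noise_centered noise_bounded T1]
    note expn = expectation_martingale[of noise "2 * Lip * radius",
        OF noise_adapted noise_centered noise_bounded T1]
    have "T * integral\<^sup>L M (\<lambda>\<omega>. res (\<lambda>t. idx t \<omega>) T) = integral\<^sup>L M (\<lambda>\<omega>. T * res (\<lambda>t. idx t \<omega>) T)"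
      by simp
    also have "\<dots> \<le> integral\<^sup>L M (\<lambda>\<omega>. K * (1 + ln T) + (\<Sum>t=1..T. noise t (\<lambda>t. idx t \<omega>)))"
      using int intn K(2)[OF valid_samples T1] by (intro integral_mono) auto
    also have "\<dots> = K * (1 + ln T)"
      using intn expn by (subst Bochner_Integration.integral_add) (auto simp: prob_space)
    also have "\<dots> \<le> K' * ln T"
    proof -
      have "K * 1 \<le> K * ln T" "0 \<le> 3 * (Lip * radius) * ln T"
        using K(1) Lip_nonneg radius_nonneg ln_ge_1[OF T] by (intro mult_left_mono mult_nonneg_nonneg; simp)+
      then show ?thesis
        by (simp add: K'_def algebra_simps)
    qed
    finally have up: "integral\<^sup>L M (\<lambda>\<omega>. res (\<lambda>t. idx t \<omega>) T) \<le> K' * (ln (real T) / real T)"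
      using T0 by (simp add: pos_le_divide_eq mult.commute)
    have "- (K' * (ln (real T) / real T)) \<le> - (3 * Lip * radius / T)"
    proof -
      have "(3 * Lip * radius) * 1 \<le> K' * ln T"
        using K(1) Lip_nonneg radius_nonneg ln_ge_1[OF T] unfolding K'_def by (intro mult_mono) auto
      then show ?thesis
        using T0 by (simp add: divide_right_mono)
    qed
    also have "\<dots> = integral\<^sup>L M (\<lambda>_. - (3 * Lip * radius / T))"
      by (simp add: prob_space)
    also have "\<dots> \<le> integral\<^sup>L M (\<lambda>\<omega>. res (\<lambda>t. idx t \<omega>) T)"
      using int res_lower[OF opt valid_samples T1] by (intro integral_mono) auto
    finally show ?thesis
      using up by linarith
  qed
  then show ?thesis
    by (intro bigoI[of _ K'] eventually_mono[OF eventually_ge_at_top[of 3]])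
      (auto simp: abs_mult ln_ge_zero)
qed

lemma tail_bound:
  "\<exists>k1>0. \<exists>k2>0. \<forall>\<epsilon>>0. \<forall>T\<ge>3.
     measure M {\<omega> \<in> space M. k1 * (ln (real T) / real T) + k2 * (\<epsilon> / sqrt (real T)) \<le> res (\<lambda>t. idx t \<omega>) T}
       \<le> exp (- (\<epsilon>\<^sup>2 / 16))"
proof -
  obtain K :: real where K: "K \<ge> 0"
    "\<And>s T. valid s \<Longrightarrow> T \<ge> 1 \<Longrightarrow> T * res s T \<le> K * (1 + ln T) + (\<Sum>t=1..T. noise t s)"
    using res_le_noise by blast
  \<comment> \<open>The added 1 keeps \<open>b\<close> positive even if \<open>Lip\<close> or
    \<open>radius\<close> vanishes; \<open>b\<close> serves both as Azuma bound and as
    \<open>k2\<close>. The 1 in \<open>k\<close> below does the same for \<open>k1\<close>.\<close>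
  define b where "b = 2 * Lip * radius + 1"
  have b: "b > 0"
    using Lip_nonneg radius_nonneg by (simp add: b_def add_nonneg_pos)
  have bounded: "\<bar>noise t \<sigma>\<bar> \<le> b" if "t \<ge> 1" "\<And>\<tau>. \<tau> \<in> {1..t} \<Longrightarrow> \<sigma> \<tau> \<in> {1..n}" for t \<sigma>
    using noise_bounded[of t \<sigma>, OF that] by (simp add: b_def)
  define k where "k = 2 * K + 1"
  have "measure M {\<omega> \<in> space M. k * (ln (real T) / real T) + b * (\<epsilon> / sqrt (real T)) \<le> res (\<lambda>t. idx t \<omega>) T}
      \<le> exp (- (\<epsilon>\<^sup>2 / 16))" if \<epsilon>: "\<epsilon> > 0" and T: "T \<ge> 3" for \<epsilon> :: real and T
  proof -
    have T1: "T \<ge> 1" and T0: "real T > 0"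
      using T by auto
    \<comment> \<open>The deviation term multiplied by \<open>T\<close>. With it the Azuma exponent
      is \<open>\<epsilon>^2 / 2\<close>, which is stronger than the required
      \<open>\<epsilon>^2 / 16\<close>.\<close>
    define \<delta> where "\<delta> = b * \<epsilon> * sqrt T"
    have \<delta>: "\<delta> > 0"
      using b \<epsilon> T0 by (simp add: \<delta>_def)
    have "\<delta> \<le> (\<Sum>t=1..T. noise t (\<lambda>t. idx t \<omega>))"
      if \<omega>: "\<omega> \<in> space M" and le: "k * (ln (real T) / real T) + b * (\<epsilon> / sqrt (real T)) \<le> res (\<lambda>t. idx t \<omega>) T" for \<omega>
    proof -
      have "T * (k * (ln (real T) / real T) + b * (\<epsilon> / sqrt (real T))) = k * ln T + b * \<epsilon> * (T / sqrt T)"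
        using T0 by (simp add: distrib_left)
      then have "k * ln T + \<delta> \<le> T * res (\<lambda>t. idx t \<omega>) T"
        using mult_left_mono[OF le, of T] by (simp add: \<delta>_def real_div_sqrt)
      moreover have "K * (1 + ln T) \<le> k * ln T"
      proof -
        have "K * 1 \<le> K * ln T" "0 \<le> ln T"
          using K(1) ln_ge_1[OF T] mult_left_mono[of 1 "ln (real T)" K] by auto
        then show ?thesis
          by (simp add: k_def algebra_simps)
      qed
      ultimately show ?thesis
        using K(2)[OF valid_samples[OF \<omega>] T1] by linarith
    qed
    then have "{\<omega> \<in> space M. k * (ln (real T) / real T) + b * (\<epsilon> / sqrt (real T)) \<le> res (\<lambda>t. idx t \<omega>) T}
        \<subseteq> {\<omega> \<in> space M. \<delta> \<le> (\<Sum>t=1..T. noise t (\<lambda>t. idx t \<omega>))}"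
      by blast
    moreover have "(\<lambda>\<omega>. \<Sum>t=1..T. noise t (\<lambda>t. idx t \<omega>)) \<in> borel_measurable M"
      using integrable_martingale[of noise b, OF noise_adapted noise_centered bounded T1] by auto
    then have "{\<omega> \<in> space M. \<delta> \<le> (\<Sum>t=1..T. noise t (\<lambda>t. idx t \<omega>))} \<in> events"
      by measurable
    ultimately have "prob {\<omega> \<in> space M. k * (ln (real T) / real T) + b * (\<epsilon> / sqrt (real T)) \<le> res (\<lambda>t. idx t \<omega>) T}
        \<le> prob {\<omega> \<in> space M. \<delta> \<le> (\<Sum>t=1..T. noise t (\<lambda>t. idx t \<omega>))}"
      by (rule finite_measure_mono)
    also have "\<dots> \<le> exp (- (\<delta>\<^sup>2 / (2 * b\<^sup>2 * real T)))"
      by (rule Azuma_uniform[of noise b, OF noise_adapted noise_centered bounded T1 b \<delta>])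
    also have "\<delta>\<^sup>2 / (2 * b\<^sup>2 * real T) = \<epsilon>\<^sup>2 / 2"
      using b T0 by (simp add: \<delta>_def power_mult_distrib)
    also have "exp (- (\<epsilon>\<^sup>2 / 2)) \<le> exp (- (\<epsilon>\<^sup>2 / 16))"
      by simp
    finally show ?thesis .
  qed
  moreover have "k > 0"
    using K(1) by (simp add: k_def)
  ultimately show ?thesis
    using b by blast
qed

end

end

section \<open>Application to the l_p model\<close>

theorem theorem1:
  fixes F :: "real ^ 'd \<Rightarrow> real ^ 'm \<Rightarrow> real ^ 'N"
    and x :: "nat \<Rightarrow> real ^ 'm" and n :: nat
    and g :: "real ^ 'd \<Rightarrow> real" and C :: "(real ^ 'd) set"
    and p h \<beta> :: real and \<theta>k \<theta>s :: "real ^ 'd"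
    and L :: "nat \<Rightarrow> real ^ 'd \<Rightarrow> real" and G :: "real ^ 'd \<Rightarrow> ereal"
    and \<rho> \<gamma> :: "nat \<Rightarrow> real"
    and P :: "'w measure" and idx :: "nat \<Rightarrow> 'w \<Rightarrow> nat"
  assumes n: "n \<ge> 1" and p: "p \<ge> 1" and h: "h > 0" and \<beta>: "\<beta> > 0"
    and F_smooth: "\<And>y. smooth (\<lambda>\<theta>. F \<theta> y)"
    and g_convex: "convex_on UNIV g" and g_bdd_below: "bdd_below (range g)"
    and C: "convex C" "closed C" "bounded C" and \<theta>k: "\<theta>k \<in> C"
    and g_nonneg: "g 0 = 0" "\<And>\<theta>. g \<theta> \<ge> 0"
    and g_lipschitz: "\<exists>K. K-lipschitz_on C g"
    and g_strongly_convex: "strongly_convex_on \<beta> C g"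
    and F_bounded: "\<And>i. i \<in> {1..n} \<Longrightarrow> bounded ((\<lambda>\<theta>. F \<theta> (x i)) ` C)"
    and DF_bounded:
      "\<And>i. i \<in> {1..n} \<Longrightarrow> bounded ((\<lambda>\<theta>. jacobian (\<lambda>\<theta>'. F \<theta>' (x i)) (at \<theta>)) ` C)"
    and L: "L = (\<lambda>i. loc_model p h \<theta>k (\<lambda>\<theta>. F \<theta> (x i)))"
    and G: "G = (\<lambda>\<theta>. ereal (g \<theta>) + chi C \<theta>)"
    and \<theta>s: "is_arg_min (\<lambda>(\<theta>1, \<theta>2). ereal (avg_loss n L \<theta>1) + G \<theta>2) (\<lambda>(\<theta>1, \<theta>2). \<theta>1 = \<theta>2) (\<theta>s, \<theta>s)"
    and \<gamma>: "\<gamma> = (\<lambda>t. h * real t)" and \<rho>: "\<rho> = (\<lambda>t. \<beta> * real t)"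
    and P: "prob_space P"
    and idx_indep: "prob_space.indep_vars P (\<lambda>_. count_space {1..n}) idx {1..}"
    and idx_uniform:
      "\<And>t. t \<ge> 1 \<Longrightarrow> distr P (count_space {1..n}) (idx t) = uniform_count_measure {1..n}"
  shows
    "(\<exists>K. \<forall>\<^sub>F T in sequentially. \<forall>s. (\<forall>t\<ge>1. s t \<in> {1..n}) \<longrightarrow>
        (norm (theta1_avg L G \<rho> \<gamma> s T - theta2_avg L G \<rho> \<gamma> s T))\<^sup>2 \<le> K * (ln (real T) / real T))
   \<and> (\<forall>T\<ge>1. (\<forall>\<omega>\<in>space P. \<bar>residual n L G \<rho> \<gamma> \<theta>s (\<lambda>t. idx t \<omega>) T\<bar> \<noteq> \<infinity>) \<and>
        integrable P (\<lambda>\<omega>. real_of_ereal (residual n L G \<rho> \<gamma> \<theta>s (\<lambda>t. idx t \<omega>) T)))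
   \<and> (\<lambda>T. \<integral>\<omega>. real_of_ereal (residual n L G \<rho> \<gamma> \<theta>s (\<lambda>t. idx t \<omega>) T) \<partial>P)
        \<in> O(\<lambda>T. ln (real T) / real T)
   \<and> (\<exists>k1>0. \<exists>k2>0. \<forall>M>0. \<forall>T\<ge>3.
        measure P {\<omega> \<in> space P. residual n L G \<rho> \<gamma> \<theta>s (\<lambda>t. idx t \<omega>) T
                     \<ge> ereal (k1 * (ln (real T) / real T) + k2 * (M / sqrt (real T)))}
          \<le> exp (- (M\<^sup>2 / 16)))"
proof -
  have "\<exists>D\<ge>0. \<forall>i\<in>{1..n}. real CARD('N) powr (1 / p)
      * onorm ((*v) (jacobian (\<lambda>\<theta>. F \<theta> (x i)) (at \<theta>k))) \<le> D"
  proof -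
    let ?d = "\<lambda>i. real CARD('N) powr (1 / p) * onorm ((*v) (jacobian (\<lambda>\<theta>. F \<theta> (x i)) (at \<theta>k)))"
    have d: "?d i \<ge> 0" for i
      by (intro mult_nonneg_nonneg onorm_pos_le) auto
    \<comment> \<open>The sum of finitely many nonnegative constants bounds each of them.\<close>
    then show ?thesis
      by (intro exI[of _ "\<Sum>i=1..n. ?d i"]) (auto intro!: sum_nonneg member_le_sum)
  qed
  then obtain D where D: "D \<ge> 0" "\<And>i. i \<in> {1..n} \<Longrightarrow> real CARD('N) powr (1 / p)
      * onorm ((*v) (jacobian (\<lambda>\<theta>. F \<theta> (x i)) (at \<theta>k))) \<le> D"
    by blast
  define \<phi> where "\<phi> = (\<lambda>i \<theta>. lp_norm p (F \<theta>k (x i)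
    + jacobian (\<lambda>\<theta>. F \<theta> (x i)) (at \<theta>k) *v (\<theta> - \<theta>k)))"
  have min: "ereal (avg_loss n L \<theta>s) + G \<theta>s \<le> ereal (avg_loss n L y) + G y" for y
    using \<theta>s by (auto simp: is_arg_min_linorder)
  \<comment> \<open>The objective is finite at the feasible pair given by \<theta>^k, so a minimizer
    cannot lie outside \<open>C\<close>.\<close>
  have \<theta>sC: "\<theta>s \<in> C"
    using min[of \<theta>k] \<theta>k by (auto simp: G chi_def split: if_splits)
  obtain K where "K-lipschitz_on C g"
    using g_lipschitz by blast
  interpret S: sadm_problem n \<phi> h \<beta> D \<theta>k \<theta>s g C
  proof
    show "\<bar>\<phi> i y - \<phi> i w\<bar> \<le> D * norm (y - w)" if "i \<in> {1..n}" for i y w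
      unfolding \<phi>_def
      by (rule order_trans[OF lp_norm_affine_Lipschitz[OF p] mult_right_mono[OF D(2)[OF that]]]) simp
    show "convex_on UNIV (\<phi> i)" for i
      unfolding \<phi>_def by (rule lp_norm_affine_convex[OF p])
    show "continuous_on C g"
      by (rule lipschitz_on_continuous_on) fact
    show "compact C"
      using C by (simp add: compact_eq_bounded_closed)
  qed (use n h \<beta> D(1) g_nonneg(2) g_strongly_convex \<theta>sC in \<open>auto simp: \<phi>_def lp_norm_nonneg\<close>)
  have L_eq: "L = S.loss"
    unfolding L loc_model_def S.loss_def fun_eq_iff unfolding \<phi>_def by simp
  have G_eq: "G = S.reg"
    by (simp add: G S.reg_def fun_eq_iff)
  have opt: "S.mean_loss \<theta>s + g \<theta>s \<le> S.mean_loss y + g y" if "y \<in> C" for y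
    using min[of y] that \<theta>sC by (simp add: S.mean_loss_def L_eq G chi_def)
  have U: "uniform_samples P idx n"
    using P n idx_indep idx_uniform by (simp add: uniform_samples_def uniform_samples_axioms_def)
  note [simp] = S.residual_eq[OF S.valid_samples[OF U]]
  have int_eq: "integral\<^sup>L P (\<lambda>\<omega>. real_of_ereal (residual n L G \<rho> \<gamma> \<theta>s (\<lambda>t. idx t \<omega>) T))
      = integral\<^sup>L P (\<lambda>\<omega>. S.res (\<lambda>t. idx t \<omega>) T)" if "T \<ge> 1" for T
    unfolding L_eq G_eq \<rho> \<gamma> using that by (intro Bochner_Integration.integral_cong) auto
  have i: "\<exists>K. \<forall>\<^sub>F T in sequentially. \<forall>s. (\<forall>t\<ge>1. s t \<in> {1..n}) \<longrightarrow>
      (norm (theta1_avg L G \<rho> \<gamma> s T - theta2_avg L G \<rho> \<gamma> s T))\<^sup>2 \<le> K * (ln (real T) / real T)"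
    using S.gap_rate unfolding S.valid_def S.avg1_def S.avg2_def L_eq G_eq \<rho> \<gamma> .
  have fin: "\<bar>residual n L G \<rho> \<gamma> \<theta>s (\<lambda>t. idx t \<omega>) T\<bar> \<noteq> \<infinity>" if "T \<ge> 1" "\<omega> \<in> space P" for T \<omega>
    unfolding L_eq G_eq \<rho> \<gamma> using that by simp
  have int: "integrable P (\<lambda>\<omega>. real_of_ereal (residual n L G \<rho> \<gamma> \<theta>s (\<lambda>t. idx t \<omega>) T))" if "T \<ge> 1" for T
    unfolding L_eq G_eq \<rho> \<gamma>
    by (rule iffD1[OF Bochner_Integration.integrable_cong S.integrable_res[OF U that]]) (use that in auto)
  have ii: "(\<lambda>T. \<integral>\<omega>. real_of_ereal (residual n L G \<rho> \<gamma> \<theta>s (\<lambda>t. idx t \<omega>) T) \<partial>P)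
      \<in> O(\<lambda>T. ln (real T) / real T)"
  proof (rule iffD2[OF landau_o.big.in_cong S.expectation_rate[OF U]])
    show "\<forall>\<^sub>F T in sequentially. (\<integral>\<omega>. real_of_ereal (residual n L G \<rho> \<gamma> \<theta>s (\<lambda>t. idx t \<omega>) T) \<partial>P)
        = integral\<^sup>L P (\<lambda>\<omega>. S.res (\<lambda>t. idx t \<omega>) T)"
      by (rule eventually_mono[OF eventually_ge_at_top[of 1] int_eq])
  qed (rule opt)
  obtain k1 k2 where k: "k1 > 0" "k2 > 0" and tail: "\<And>M T. M > 0 \<Longrightarrow> T \<ge> 3 \<Longrightarrow>
      measure P {\<omega> \<in> space P. k1 * (ln (real T) / real T) + k2 * (M / sqrt (real T)) \<le> S.res (\<lambda>t. idx t \<omega>) T}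
        \<le> exp (- (M\<^sup>2 / 16))"
    using S.tail_bound[OF U] by blast
  have iii: "measure P {\<omega> \<in> space P. residual n L G \<rho> \<gamma> \<theta>s (\<lambda>t. idx t \<omega>) T
        \<ge> ereal (k1 * (ln (real T) / real T) + k2 * (M / sqrt (real T)))} \<le> exp (- (M\<^sup>2 / 16))"
    if M: "M > 0" and T: "T \<ge> 3" for M :: real and T
  proof -
    have "{\<omega> \<in> space P. residual n L G \<rho> \<gamma> \<theta>s (\<lambda>t. idx t \<omega>) T
        \<ge> ereal (k1 * (ln (real T) / real T) + k2 * (M / sqrt (real T)))}
      = {\<omega> \<in> space P. k1 * (ln (real T) / real T) + k2 * (M / sqrt (real T)) \<le> S.res (\<lambda>t. idx t \<omega>) T}"
      unfolding L_eq G_eq \<rho> \<gamma> using T by auto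
    then show ?thesis
      using tail[OF M T] by simp
  qed
  show ?thesis
    by (intro conjI allI impI ballI i ii fin int exI[of _ k1] exI[of _ k2] k iii)
qed

end
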